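(* Any immersion $u\in W^{2,2}([0,1],\mathbb{H}^2)$ with $\mathcal{E}(u)\le8$ is an embedding.
   Context: $\mathbb{H}^2=\{(y^{(1)},y^{(2)})^t\in\mathbb{R}^2:y^{(2)}>0\}$ with metric $g_{(y^{(1)},y^{(2)})}=(y^{(2)})^{-2}\langle\cdot,\cdot\rangle$, where $\langle\cdot,\cdot\rangle$ is Euclidean. $u\in W^{2,2}([0,1],\mathbb{H}^2)$ means $u\in W^{2,2}([0,1],\mathbb{R}^2)$ (Euclidean Sobolev space, so $u\in C^1$) with $u([0,1])\subseteq\mathbb{H}^2$; immersion means $\partial_xu\ne0$ on $[0,1]$. For such $u$, $ds=|\partial_xu|_g\,dx$, $\partial_s=|\partial_xu|_g^{-1}\partial_x$, $\nabla_x$ is the covariant derivative along $u$ of the Levi-Civita connection of $g$, i.e. for a vector field $X=(X^{(1)},X^{(2)})^t$ along $u$, $$\nabla_xX=\begin{pmatrix}\partial_xX^{(1)}-\frac1{u^{(2)}}(X^{(1)}\partial_xu^{(2)}+X^{(2)}\partial_xu^{(1)})\\ \partial_xX^{(2)}+\frac1{u^{(2)}}(X^{(1)}\partial_xu^{(1)}-X^{(2)}\partial_xu^{(2)})\end{pmatrix},$$ $\nabla_s=|\partial_xu|_g^{-1}\nabla_x$, $\vec\kappa=\nabla_s\partial_su$ is the curvature and $\mathcal{E}(u)=\int_0^1|\vec\kappa|_g^2\,ds$ the elastic energy. *)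

theory Defs
  imports "HOL-Analysis.Analysis"
begin

definition test_functions :: "real set \<Rightarrow> (real \<Rightarrow> real) set" where
  "test_functions S = {\<phi>. (\<forall>n x. (deriv ^^ n) \<phi> field_differentiable at x) \<and>
     compact (closure {x. \<phi> x \<noteq> 0}) \<and> closure {x. \<phi> x \<noteq> 0} \<subseteq> S}"

definition locally_integrable :: "real set \<Rightarrow> (real \<Rightarrow> 'a::euclidean_space) \<Rightarrow> bool" where
  "locally_integrable S f \<longleftrightarrow> (\<forall>K. compact K \<and> K \<subseteq> S \<longrightarrow> f absolutely_integrable_on K)"

definition has_weak_deriv ::
    "real set \<Rightarrow> (real \<Rightarrow> 'a::euclidean_space) \<Rightarrow> (real \<Rightarrow> 'a) \<Rightarrow> bool" where
  "has_weak_deriv S f f' \<longleftrightarrow> locally_integrable S f \<and> locally_integrable S f' \<and>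
     (\<forall>\<phi>\<in>test_functions S.
        (LINT x:S|lebesgue. deriv \<phi> x *\<^sub>R f x) = - (LINT x:S|lebesgue. \<phi> x *\<^sub>R f' x))"

text \<open>A representative of the weak derivative, which is unique up to a null set.\<close>

definition weak_deriv :: "real set \<Rightarrow> (real \<Rightarrow> 'a::euclidean_space) \<Rightarrow> real \<Rightarrow> 'a" where
  "weak_deriv S f = (SOME f'. has_weak_deriv S f f')"

definition L2 :: "real set \<Rightarrow> (real \<Rightarrow> 'a::euclidean_space) set" where
  "L2 S = {f. set_borel_measurable lebesgue S f \<and>
              (\<lambda>x. (norm (f x))\<^sup>2) absolutely_integrable_on S}"

text \<open>
  The Sobolev space on the unit interval. An element is a function and not a class of functions:
  it is the representative that is continuous on the closed interval (and then automatically
  continuously differentiable there, with one-sided derivatives at the end points).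
\<close>

definition W22 :: "(real \<Rightarrow> 'a::euclidean_space) set" where
  "W22 = {u. continuous_on {0..1} u \<and> u \<in> L2 {0<..<1} \<and>
     (\<exists>u' u''. u' \<in> L2 {0<..<1} \<and> u'' \<in> L2 {0<..<1} \<and>
        has_weak_deriv {0<..<1} u u' \<and> has_weak_deriv {0<..<1} u' u'')}"

definition H2 :: "(real^2) set" where
  "H2 = {y. y $ 2 > 0}"

definition W22_H2 :: "(real \<Rightarrow> real^2) set" where
  "W22_H2 = {u \<in> W22. u ` {0..1} \<subseteq> H2}"

definition hyp_metric :: "real^2 \<Rightarrow> real^2 \<Rightarrow> real^2 \<Rightarrow> real" where
  "hyp_metric y v w = (v \<bullet> w) / (y $ 2)\<^sup>2"

definition hyp_norm :: "real^2 \<Rightarrow> real^2 \<Rightarrow> real" where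
  "hyp_norm y v = sqrt (hyp_metric y v v)"

definition dx :: "(real \<Rightarrow> real^2) \<Rightarrow> real \<Rightarrow> real^2" where
  "dx u x = vector_derivative u (at x within {0..1})"

definition immersion :: "(real \<Rightarrow> real^2) \<Rightarrow> bool" where
  "immersion u \<longleftrightarrow> (\<forall>x\<in>{0..1}. dx u x \<noteq> 0)"

definition speed :: "(real \<Rightarrow> real^2) \<Rightarrow> real \<Rightarrow> real" where
  "speed u x = hyp_norm (u x) (dx u x)"

definition ds :: "(real \<Rightarrow> real^2) \<Rightarrow> real \<Rightarrow> real^2" where
  "ds u x = dx u x /\<^sub>R speed u x"

text \<open>
  The Levi-Civita covariant derivative of a vector field X along u, in coordinates. The field that
  it is applied to below is only weakly differentiable, so X is differentiated in the weak sense.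
\<close>

definition cov_dx :: "(real \<Rightarrow> real^2) \<Rightarrow> (real \<Rightarrow> real^2) \<Rightarrow> real \<Rightarrow> real^2" where
  "cov_dx u X x = (let X' = weak_deriv {0<..<1} X x; u' = dx u x in
     vector [X' $ 1 - (X x $ 1 * u' $ 2 + X x $ 2 * u' $ 1) / u x $ 2,
             X' $ 2 + (X x $ 1 * u' $ 1 - X x $ 2 * u' $ 2) / u x $ 2])"

definition cov_ds :: "(real \<Rightarrow> real^2) \<Rightarrow> (real \<Rightarrow> real^2) \<Rightarrow> real \<Rightarrow> real^2" where
  "cov_ds u X x = cov_dx u X x /\<^sub>R speed u x"

definition curvature :: "(real \<Rightarrow> real^2) \<Rightarrow> real \<Rightarrow> real^2" where
  "curvature u = cov_ds u (ds u)"

definition elastic_energy :: "(real \<Rightarrow> real^2) \<Rightarrow> ennreal" where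
  "elastic_energy u =
     (\<integral>\<^sup>+x\<in>{0..1}. ennreal ((hyp_norm (u x) (curvature u x))\<^sup>2 * speed u x) \<partial>lebesgue)"

text \<open>The hyperbolic metric induces the Euclidean subspace topology on the half-plane.\<close>

definition embedding :: "(real \<Rightarrow> real^2) \<Rightarrow> bool" where
  "embedding u \<longleftrightarrow> immersion u \<and> embedding_map (top_of_set {0..1}) (top_of_set H2) u"

end

theory Submission
  imports Defs
begin

text \<open>
  Let \<open>c\<close> be a loop in the hyperbolic plane parametrised by arclength that starts and ends at \<open>P\<close> and
  does not meet \<open>P\<close> in between, and let \<open>r\<close> be the distance to \<open>P\<close>. The radial velocity \<open>w = r'\<close>
  starts at \<open>1\<close> and ends at \<open>-1\<close>. If \<open>a\<close> is the component of \<open>grad r\<close> along the unit normal, so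
  \<open>w\<^sup>2 + a\<^sup>2 = 1\<close>, and \<open>k\<close> the signed curvature, then \<open>w' = k a + coth r a\<^sup>2\<close>. Hence
  \<open>k\<^sup>2 + 4 w' = (k + 2 a)\<^sup>2 + 4 (coth r - 1) a\<^sup>2\<close>, and integration gives
  \<open>E \<ge> 8 + 4 \<integral> (coth r - 1) a\<^sup>2 ds > 8\<close>, as \<open>a\<close> does not vanish identically. An immersion that is
  not injective contains such a loop, and an injective one is an embedding by compactness.
\<close>

section \<open>Absolutely continuous functions\<close>

text \<open>The factor 4 is 2 \<lambda> at \<lambda> = 2 in k^2 + 2 \<lambda> w' = (k + \<lambda>
  a)^2 + (2 \<lambda> coth r - \<lambda>^2) a^2. As w drops by 2, this gives E \<ge> 4 \<lambda>
  whenever the last coefficient is nonnegative; coth r comes arbitrarily close to 1 far from P, so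
  \<lambda> = 2 is the largest choice good for every r. Two obstacles shape the proof. At P itself r
  is not differentiable and coth r is infinite, so w' is integrated only over compact subintervals
  of the open parameter interval, and a contribution of the last term fixed beforehand absorbs the
  deficit of w at the ends. Moreover the curve has second derivatives only almost everywhere, while
  the energy involves an arbitrarily chosen weak derivative of the unit tangent: weak derivatives
  have to be identified with absolutely continuous representatives, and shown to be unique, before
  the formula for w' can be applied.\<close>

text \<open>
  On \<open>[a, b]\<close>, \<open>f\<close> is absolutely continuous and \<open>f'\<close> represents its derivative almost everywhere. The
  integral form lets the whole calculus avoid differentiation almost everywhere.
\<close>

definition has_ac_deriv :: "(real \<Rightarrow> real) \<Rightarrow> (real \<Rightarrow> real) \<Rightarrow> real \<Rightarrow> real \<Rightarrow> bool" where
  "has_ac_deriv f f' a b \<longleftrightarrow> f' absolutely_integrable_on {a..b} \<and>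
     (\<forall>s t. a \<le> s \<and> s \<le> t \<and> t \<le> b \<longrightarrow> (f' has_integral (f t - f s)) {s..t})"

lemma has_ac_deriv_continuous_on:
  assumes "has_ac_deriv f f' a b"
  shows "continuous_on {a..b} f"
proof -
  have "f' integrable_on {a..b}"
    using assms by (simp add: has_ac_deriv_def set_lebesgue_integral_eq_integral(1))
  then have "continuous_on {a..b} (\<lambda>x. f a + integral {a..x} f')"
    by (intro continuous_intros indefinite_integral_continuous_1)
  moreover have "f a + integral {a..x} f' = f x" if "x \<in> {a..b}" for x
  proof -
    have "(f' has_integral (f x - f a)) {a..x}"
      using assms that by (simp add: has_ac_deriv_def)
    then show ?thesis by (simp add: integral_unique)
  qed
  ultimately show ?thesis
    by (metis (no_types, lifting) continuous_on_cong)
qed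

lemma has_ac_deriv_subset:
  assumes "has_ac_deriv f f' a b" "a \<le> c" "d \<le> b"
  shows "has_ac_deriv f f' c d"
  using assms unfolding has_ac_deriv_def
  by (auto intro: absolutely_integrable_on_subinterval)

lemma has_ac_deriv_cong:
  assumes "has_ac_deriv f f' a b" "\<And>x. x \<in> {a..b} \<Longrightarrow> f x = g x" "\<And>x. x \<in> {a..b} \<Longrightarrow> f' x = g' x"
  shows "has_ac_deriv g g' a b"
proof -
  have "f' absolutely_integrable_on {a..b} \<longleftrightarrow> g' absolutely_integrable_on {a..b}"
    using assms(3) by (intro absolutely_integrable_spike_eq[of "{}"]) auto
  moreover have "(g' has_integral (g t - g s)) {s..t}" if "a \<le> s" "s \<le> t" "t \<le> b" for s t
  proof -
    have "(f' has_integral (f t - f s)) {s..t}"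
      using assms(1) that by (simp add: has_ac_deriv_def)
    then show ?thesis
      using that assms(2)[of s] assms(2)[of t] has_integral_cong[of "{s..t}" g' f'] assms(3)
      by simp
  qed
  ultimately show ?thesis
    using assms(1) by (simp add: has_ac_deriv_def)
qed

lemma has_ac_deriv_const: "has_ac_deriv (\<lambda>_. c) (\<lambda>_. 0) a b"
  by (auto simp: has_ac_deriv_def)

lemma has_ac_deriv_add:
  assumes "has_ac_deriv f f' a b" "has_ac_deriv g g' a b"
  shows "has_ac_deriv (\<lambda>x. f x + g x) (\<lambda>x. f' x + g' x) a b"
  using assms unfolding has_ac_deriv_def
proof (intro conjI allI impI; elim conjE)
  fix s t assume "a \<le> s" "s \<le> t" "t \<le> b"
    and "\<forall>s t. a \<le> s \<and> s \<le> t \<and> t \<le> b \<longrightarrow> (f' has_integral f t - f s) {s..t}"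
    and "\<forall>s t. a \<le> s \<and> s \<le> t \<and> t \<le> b \<longrightarrow> (g' has_integral g t - g s) {s..t}"
  then have "(f' has_integral f t - f s) {s..t}" "(g' has_integral g t - g s) {s..t}"
    by auto
  from has_integral_add[OF this] show "((\<lambda>x. f' x + g' x) has_integral f t + g t - (f s + g s)) {s..t}"
    by (simp add: algebra_simps)
qed (rule set_integral_add(1))

lemma has_ac_deriv_cmult:
  assumes "has_ac_deriv f f' a b"
  shows "has_ac_deriv (\<lambda>x. c * f x) (\<lambda>x. c * f' x) a b"
  using assms unfolding has_ac_deriv_def
proof (intro conjI allI impI; elim conjE)
  fix s t assume "a \<le> s" "s \<le> t" "t \<le> b"
    and "\<forall>s t. a \<le> s \<and> s \<le> t \<and> t \<le> b \<longrightarrow> (f' has_integral f t - f s) {s..t}"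
  then have "(f' has_integral f t - f s) {s..t}"
    by auto
  from has_integral_mult_right[OF this, of c] show "((\<lambda>x. c * f' x) has_integral c * f t - c * f s) {s..t}"
    by (simp add: algebra_simps)
qed (auto intro: set_integrable_mult_right)

lemma has_ac_deriv_diff:
  assumes "has_ac_deriv f f' a b" "has_ac_deriv g g' a b"
  shows "has_ac_deriv (\<lambda>x. f x - g x) (\<lambda>x. f' x - g' x) a b"
  using has_ac_deriv_add[OF assms(1) has_ac_deriv_cmult[OF assms(2), of "-1"]] by simp

text \<open>
  By the mean value theorem and the intermediate value theorem,
  \<open>F (f d) - F (f c) = F' (f \<tau>) * (f d - f c)\<close> for some \<open>\<tau>\<close> in \<open>[c, d]\<close>; so on short intervals the
  error in the formula is at most \<open>e \<integral> \<bar>f'\<bar>\<close>, and such errors add up.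
\<close>

lemma has_ac_deriv_chain:
  assumes ac: "has_ac_deriv f f' a b"
    and der: "\<And>t. t \<in> {a..b} \<Longrightarrow> (F has_real_derivative F' (f t)) (at (f t))"
    and cont: "continuous_on {a..b} (\<lambda>t. F' (f t))"
  shows "has_ac_deriv (\<lambda>t. F (f t)) (\<lambda>t. F' (f t) * f' t) a b"
proof -
  let ?g = "\<lambda>t. F' (f t) * f' t"
  have abs_f': "f' absolutely_integrable_on {a..b}"
    using ac by (simp add: has_ac_deriv_def)
  have meas: "(\<lambda>t. F' (f t)) \<in> borel_measurable (lebesgue_on {a..b})"
    using cont by (intro continuous_imp_measurable_on_sets_lebesgue) auto
  have bdd: "bounded ((\<lambda>t. F' (f t)) ` {a..b})"
    using cont by (intro compact_imp_bounded compact_continuous_image) auto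
  have abs_g: "?g absolutely_integrable_on {a..b}"
    by (rule absolutely_integrable_bounded_measurable_product_real[OF meas _ bdd abs_f']) auto
  have contf: "continuous_on {a..b} f"
    using ac by (rule has_ac_deriv_continuous_on)
  have mvt: "\<exists>\<tau>\<in>{c..d}. F (f d) - F (f c) = F' (f \<tau>) * (f d - f c)"
    if cd: "a \<le> c" "c \<le> d" "d \<le> b" for c d
  proof -
    have contcd: "continuous_on {c..d} f"
      using contf by (rule continuous_on_subset) (use cd in auto)
    have conv: "connected (f ` {c..d})"
      by (intro connected_continuous_image contcd) auto
    have key: "\<exists>\<tau>\<in>{c..d}. F q - F p = F' (f \<tau>) * (q - p)"
      if "p \<in> f ` {c..d}" "q \<in> f ` {c..d}" "p < q" for p q
    proof -
      \<comment> \<open>\<open>F\<close> is known to be differentiable only at values of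
        \<open>f\<close>; by connectedness every point between two values is again one.\<close>
      have sub: "{p..q} \<subseteq> f ` {c..d}"
        using that conv connected_contains_Icc by blast
      have "(F has_real_derivative F' x) (at x)" if "p \<le> x" "x \<le> q" for x
        using sub that cd der by (auto simp: image_iff subset_iff)
      with MVT2[OF \<open>p < q\<close>] obtain z where "p < z" "z < q" "F q - F p = (q - p) * F' z"
        by metis
      moreover then have "z \<in> f ` {c..d}"
        using sub by auto
      ultimately show ?thesis by (auto simp: mult.commute)
    qed
    have im: "f c \<in> f ` {c..d}" "f d \<in> f ` {c..d}" using cd by auto
    consider "f c < f d" | "f d < f c" | "f c = f d" by linarith
    then show ?thesis
    proof cases
      case 1 then show ?thesis using key[OF im] by auto
    next
      case 2
      then obtain \<tau> where "\<tau> \<in> {c..d}" "F (f c) - F (f d) = F' (f \<tau>) * (f c - f d)"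
        using key[OF im(2,1)] by auto
      then show ?thesis by (intro bexI[of _ \<tau>]) (auto simp: algebra_simps)
    next
      case 3 then show ?thesis using cd by auto
    qed
  qed
  have "(?g has_integral (F (f t) - F (f s))) {s..t}" if st: "a \<le> s" "s \<le> t" "t \<le> b" for s t
  proof -
    have intg: "?g integrable_on {c..d}" and intn: "(\<lambda>x. \<bar>f' x\<bar>) integrable_on {c..d}"
      and intf: "f' integrable_on {c..d}"
      if "s \<le> c" "d \<le> t" for c d
    proof -
      have "{c..d} \<subseteq> {a..b}" using that st by auto
      then have "f' absolutely_integrable_on {c..d}" "?g absolutely_integrable_on {c..d}"
        using abs_f' abs_g by (auto intro: absolutely_integrable_on_subinterval)
      then show "?g integrable_on {c..d}" "(\<lambda>x. \<bar>f' x\<bar>) integrable_on {c..d}" "f' integrable_on {c..d}"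
        by (auto simp: absolutely_integrable_on_def)
    qed
    define err where "err c d = F (f d) - F (f c) - integral {c..d} ?g" for c d
    define N where "N c d = integral {c..d} (\<lambda>x. \<bar>f' x\<bar>)" for c d
    have err: "\<bar>err s t\<bar> \<le> e * N s t" if e: "e > 0" for e
    proof -
      \<comment> \<open>Bisection principle: a property of intervals that passes to the union of
        adjacent ones and holds on all short intervals around each point holds on the whole
        interval.\<close>
      have "s \<le> s \<and> t \<le> t \<longrightarrow> \<bar>err s t\<bar> \<le> e * N s t"
      proof (rule Bolzano[OF \<open>s \<le> t\<close>, where P = "\<lambda>c d. s \<le> c \<and> d \<le> t \<longrightarrow> \<bar>err c d\<bar> \<le> e * N c d"])
        fix c d h
        assume *: "s \<le> c \<and> d \<le> t \<longrightarrow> \<bar>err c d\<bar> \<le> e * N c d" "s \<le> d \<and> h \<le> t \<longrightarrow> \<bar>err d h\<bar> \<le> e * N d h"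
          "c \<le> d" "d \<le> h"
        show "s \<le> c \<and> h \<le> t \<longrightarrow> \<bar>err c h\<bar> \<le> e * N c h"
        proof
          assume ch: "s \<le> c \<and> h \<le> t"
          have "err c h = err c d + err d h"
            unfolding err_def
            using Henstock_Kurzweil_Integration.integral_combine[OF *(3,4) intg] ch by simp
          moreover have "N c h = N c d + N d h"
            unfolding N_def
            using Henstock_Kurzweil_Integration.integral_combine[OF *(3,4) intn] ch by simp
          ultimately show "\<bar>err c h\<bar> \<le> e * N c h"
            using * ch by (simp add: distrib_left)
        qed
      next
        fix x assume x: "s \<le> x" "x \<le> t"
        then have "x \<in> {a..b}" using st by auto
        \<comment> \<open>\<open>F' (f \<tau>)\<close> and \<open>F' (f y)\<close> are both compared
          with \<open>F' (f x)\<close>, each at the cost of \<open>e / 2\<close>.\<close>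
        then obtain \<delta> where \<delta>: "\<delta> > 0" "\<And>y. y \<in> {a..b} \<Longrightarrow> \<bar>y - x\<bar> < \<delta> \<Longrightarrow> \<bar>F' (f y) - F' (f x)\<bar> < e / 2"
          using cont e unfolding continuous_on_iff dist_real_def by (metis half_gt_zero)
        show "\<exists>d>0. \<forall>c h. c \<le> x \<and> x \<le> h \<and> h - c < d \<longrightarrow> s \<le> c \<and> h \<le> t \<longrightarrow> \<bar>err c h\<bar> \<le> e * N c h"
        proof (intro exI[of _ \<delta>] conjI allI impI \<delta>(1))
          fix c h assume ch: "c \<le> x \<and> x \<le> h \<and> h - c < \<delta>" "s \<le> c \<and> h \<le> t"
          obtain \<tau> where \<tau>: "\<tau> \<in> {c..h}" "F (f h) - F (f c) = F' (f \<tau>) * (f h - f c)"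
            using mvt[of c h] ch st by auto
          have fi: "(f' has_integral (f h - f c)) {c..h}"
            using ac ch st by (auto simp: has_ac_deriv_def)
          have "((\<lambda>y. F' (f \<tau>) * f' y - ?g y) has_integral err c h) {c..h}"
            unfolding err_def \<tau>(2)
            by (intro has_integral_diff has_integral_mult_right fi integrable_integral intg) (use ch in auto)
          then have 1: "err c h = integral {c..h} (\<lambda>y. F' (f \<tau>) * f' y - ?g y)"
            "(\<lambda>y. F' (f \<tau>) * f' y - ?g y) integrable_on {c..h}"
            by (auto simp: integral_unique)
          have "norm (integral {c..h} (\<lambda>y. F' (f \<tau>) * f' y - ?g y)) \<le> integral {c..h} (\<lambda>y. e * \<bar>f' y\<bar>)"
          proof (rule integral_norm_bound_integral[OF 1(2)])
            show "(\<lambda>y. e * \<bar>f' y\<bar>) integrable_on {c..h}"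
              using intn[of c h] ch by (intro integrable_on_mult_right) auto
            fix y assume y: "y \<in> {c..h}"
            have "\<bar>F' (f \<tau>) - F' (f x)\<bar> < e / 2" "\<bar>F' (f y) - F' (f x)\<bar> < e / 2"
              using \<delta>(2)[of \<tau>] \<delta>(2)[of y] y \<tau> ch st by auto
            then have "\<bar>F' (f \<tau>) - F' (f y)\<bar> \<le> e" by linarith
            then have "\<bar>F' (f \<tau>) - F' (f y)\<bar> * \<bar>f' y\<bar> \<le> e * \<bar>f' y\<bar>"
              by (intro mult_right_mono) auto
            then show "norm (F' (f \<tau>) * f' y - F' (f y) * f' y) \<le> e * \<bar>f' y\<bar>"
              by (simp add: left_diff_distrib[symmetric] abs_mult)
          qed
          then show "\<bar>err c h\<bar> \<le> e * N c h" by (simp add: 1 N_def)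
        qed
      qed
      then show ?thesis by simp
    qed
    have N0: "N s t \<ge> 0" unfolding N_def by (intro integral_nonneg intn) auto
    have "\<bar>err s t\<bar> \<le> e" if e: "e > 0" for e
    proof -
      \<comment> \<open>The \<open>+ 1\<close> covers the case \<open>N s t = 0\<close>.\<close>
      have "\<bar>err s t\<bar> \<le> e / (N s t + 1) * N s t"
        using err[of "e / (N s t + 1)"] e N0 by simp
      also have "\<dots> \<le> e / (N s t + 1) * (N s t + 1)"
        using e N0 by (intro mult_left_mono) auto
      also have "\<dots> = e" using N0 by simp
      finally show ?thesis .
    qed
    then have "\<bar>err s t\<bar> \<le> 0" by (rule field_le_epsilon[of _ 0, simplified])
    then have "F (f t) - F (f s) = integral {s..t} ?g" by (simp add: err_def)
    then show ?thesis using intg[of s t] by (simp add: has_integral_integral)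
  qed
  then show ?thesis
    using abs_g by (simp add: has_ac_deriv_def)
qed

text \<open>Polarisation reduces the product rule to the chain rule for squares.\<close>

lemma has_ac_deriv_mult:
  assumes "has_ac_deriv f f' a b" "has_ac_deriv g g' a b"
  shows "has_ac_deriv (\<lambda>x. f x * g x) (\<lambda>x. f' x * g x + f x * g' x) a b"
proof -
  have sq: "has_ac_deriv (\<lambda>x. (h x)\<^sup>2) (\<lambda>x. 2 * h x * h' x) a b" if "has_ac_deriv h h' a b" for h h'
    by (rule has_ac_deriv_chain[OF that, where F = "\<lambda>y. y\<^sup>2" and F' = "\<lambda>y. 2 * y"])
      (auto intro!: derivative_eq_intros continuous_intros has_ac_deriv_continuous_on[OF that])
  have "has_ac_deriv (\<lambda>x. (1/4) * ((f x + g x)\<^sup>2 - (f x - g x)\<^sup>2))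
      (\<lambda>x. (1/4) * (2 * (f x + g x) * (f' x + g' x) - 2 * (f x - g x) * (f' x - g' x))) a b"
    by (intro has_ac_deriv_cmult has_ac_deriv_diff sq has_ac_deriv_add assms)
  then show ?thesis
    by (rule has_ac_deriv_cong) (auto simp: power2_eq_square algebra_simps)
qed

lemma has_ac_deriv_inverse:
  assumes "has_ac_deriv f f' a b" "\<And>x. x \<in> {a..b} \<Longrightarrow> f x \<noteq> 0"
  shows "has_ac_deriv (\<lambda>x. inverse (f x)) (\<lambda>x. - f' x / (f x)\<^sup>2) a b"
proof -
  have "has_ac_deriv (\<lambda>x. inverse (f x)) (\<lambda>x. - (inverse (f x))\<^sup>2 * f' x) a b"
    by (rule has_ac_deriv_chain[OF assms(1), where F = inverse and F' = "\<lambda>y. - (inverse y)\<^sup>2"])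
      (use assms(2) in \<open>auto intro!: derivative_eq_intros continuous_intros
        has_ac_deriv_continuous_on[OF assms(1)] simp: power2_eq_square\<close>)
  then show ?thesis
    by (rule has_ac_deriv_cong) (auto simp: power2_eq_square field_simps)
qed

lemma has_ac_deriv_sqrt:
  assumes "has_ac_deriv f f' a b" "\<And>x. x \<in> {a..b} \<Longrightarrow> f x > 0"
  shows "has_ac_deriv (\<lambda>x. sqrt (f x)) (\<lambda>x. f' x / (2 * sqrt (f x))) a b"
proof -
  have "has_ac_deriv (\<lambda>x. sqrt (f x)) (\<lambda>x. inverse (2 * sqrt (f x)) * f' x) a b"
    by (rule has_ac_deriv_chain[OF assms(1), where F = sqrt and F' = "\<lambda>y. inverse (2 * sqrt y)"])
      (use assms(2) in \<open>force intro!: derivative_eq_intros continuous_intros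
        has_ac_deriv_continuous_on[OF assms(1)]\<close>)+
  then show ?thesis
    by (rule has_ac_deriv_cong) (auto simp: field_simps)
qed

lemma has_ac_deriv_divide:
  assumes "has_ac_deriv f f' a b" "has_ac_deriv g g' a b" "\<And>x. x \<in> {a..b} \<Longrightarrow> g x \<noteq> 0"
  shows "has_ac_deriv (\<lambda>x. f x / g x) (\<lambda>x. (f' x * g x - f x * g' x) / (g x)\<^sup>2) a b"
  by (rule has_ac_deriv_cong[OF has_ac_deriv_mult[OF assms(1) has_ac_deriv_inverse[OF assms(2,3)]]])
    (use assms(3) in \<open>auto simp: field_simps power2_eq_square\<close>)

lemma has_ac_deriv_C1:
  assumes "\<And>x. (f has_real_derivative f' x) (at x)" "continuous_on UNIV f'"
  shows "has_ac_deriv f f' a b"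
  unfolding has_ac_deriv_def
proof (intro conjI allI impI)
  show "f' absolutely_integrable_on {a..b}"
    by (intro absolutely_integrable_continuous_real continuous_on_subset[OF assms(2)]) auto
  fix s t assume "a \<le> s \<and> s \<le> t \<and> t \<le> b"
  then show "(f' has_integral f t - f s) {s..t}"
    by (intro fundamental_theorem_of_calculus)
      (auto intro: assms(1) DERIV_subset has_field_derivative_at_within
        simp: has_real_derivative_iff_has_vector_derivative[symmetric])
qed

section \<open>Smooth bump functions\<close>

text \<open>The regularity clause of \<open>test_functions\<close>, separated from the support
  condition so that closure rules can be proved for it.\<close>

definition smooth :: "(real \<Rightarrow> real) \<Rightarrow> bool" where
  "smooth f \<longleftrightarrow> (\<forall>n x. (deriv ^^ n) f field_differentiable at x)"

text \<open>Derivatives are unique, so in a class where every member has some derivative in the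
  class, \<open>deriv\<close> maps the class to itself and no iterate leaves it. Most closure rules
  below only have to exhibit such a class.\<close>

lemma smooth_coinduct:
  assumes "f \<in> S" and S: "\<And>g. g \<in> S \<Longrightarrow> \<exists>g'\<in>S. \<forall>x. (g has_real_derivative g' x) (at x)"
  shows "smooth f"
proof -
  have step: "deriv g \<in> S" "g field_differentiable at x" if "g \<in> S" for g x
  proof -
    from S[OF that] obtain g' where g': "g' \<in> S" "\<forall>x. (g has_real_derivative g' x) (at x)"
      by (rule bexE)
    then have "deriv g = g'" by (auto intro: DERIV_imp_deriv)
    with g' show "deriv g \<in> S" "g field_differentiable at x"
      by (auto simp: field_differentiable_def)
  qed
  have "(deriv ^^ n) f \<in> S" for n
    by (induction n) (auto simp: \<open>f \<in> S\<close> step)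
  then show ?thesis
    by (auto simp: smooth_def step)
qed

lemma smooth_deriv: "smooth f \<Longrightarrow> smooth (deriv f)"
  unfolding smooth_def by (metis funpow_simps_right(2) o_apply)

lemma smooth_has_derivative: "smooth f \<Longrightarrow> (f has_real_derivative deriv f x) (at x)"
  unfolding smooth_def by (metis DERIV_deriv_iff_field_differentiable funpow_0)

lemma smooth_continuous_on: "smooth f \<Longrightarrow> continuous_on S f"
  by (meson DERIV_continuous_on has_field_derivative_at_within smooth_has_derivative)

lemma smooth_antiderivative:
  assumes "\<And>x. (f has_real_derivative g x) (at x)" "smooth g"
  shows "smooth f"
  by (rule smooth_coinduct[of _ "insert f (Collect smooth)"])
    (use assms smooth_deriv smooth_has_derivative in blast)+

lemma smooth_const: "smooth (\<lambda>_. c)"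
proof (rule smooth_coinduct[of _ "range (\<lambda>c _. c)"])
  show "\<exists>g'\<in>range (\<lambda>c _. c). \<forall>x. (g has_real_derivative g' x) (at x)"
    if "g \<in> range (\<lambda>c _. c)" for g :: "real \<Rightarrow> real"
    using that by (intro bexI[of _ "\<lambda>_. 0"]) auto
qed auto

text \<open>Sums of products of smooth functions are closed under differentiation, unlike products alone.\<close>

inductive_set smooth_ring :: "(real \<Rightarrow> real) set" where
  mult: "smooth f \<Longrightarrow> smooth g \<Longrightarrow> (\<lambda>x. f x * g x) \<in> smooth_ring"
| add: "p \<in> smooth_ring \<Longrightarrow> q \<in> smooth_ring \<Longrightarrow> (\<lambda>x. p x + q x) \<in> smooth_ring"

lemma smooth_ring_imp_smooth: "h \<in> smooth_ring \<Longrightarrow> smooth h"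
proof (erule smooth_coinduct)
  show "\<exists>g'\<in>smooth_ring. \<forall>x. (g has_real_derivative g' x) (at x)" if "g \<in> smooth_ring" for g
    using that
  proof induction
    case (mult f g)
    let ?d = "\<lambda>x. deriv f x * g x + f x * deriv g x"
    have "?d \<in> smooth_ring"
      by (rule smooth_ring.add; rule smooth_ring.mult; intro mult smooth_deriv)
    moreover have "((\<lambda>x. f x * g x) has_real_derivative ?d x) (at x)" for x
      using mult by (auto intro!: derivative_eq_intros smooth_has_derivative)
    ultimately show ?case by (intro bexI[of _ ?d]) auto
  next
    case (add p q)
    from add.IH(1) obtain p' where "p' \<in> smooth_ring" "\<forall>x. (p has_real_derivative p' x) (at x)"
      by (rule bexE)
    moreover from add.IH(2) obtain q' where "q' \<in> smooth_ring" "\<forall>x. (q has_real_derivative q' x) (at x)"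
      by (rule bexE)
    ultimately show ?case
      by (intro bexI[of _ "\<lambda>x. p' x + q' x"]) (auto intro: derivative_intros smooth_ring.add)
  qed
qed

lemma smooth_mult: "smooth f \<Longrightarrow> smooth g \<Longrightarrow> smooth (\<lambda>x. f x * g x)"
  by (rule smooth_ring_imp_smooth, rule smooth_ring.mult)

lemma smooth_diff_cmult:
  assumes "smooth f" "smooth g"
  shows "smooth (\<lambda>x. f x - c * g x)"
  using smooth_ring.add[OF smooth_ring.mult[OF assms(1) smooth_const[of 1]]
      smooth_ring.mult[OF assms(2) smooth_const[of "-c"]]]
  by (auto dest!: smooth_ring_imp_smooth simp: mult.commute)

text \<open>The scalar \<open>k\<close> makes the class closed under differentiation: it collects
  the factors \<open>c\<close> produced by the chain rule.\<close>

lemma smooth_affine: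
  assumes "smooth f"
  shows "smooth (\<lambda>x. f (c * x + d))"
proof (rule smooth_coinduct[of _ "{\<lambda>x. k * f (c * x + d) |k f. smooth f}"])
  show "(\<lambda>x. f (c * x + d)) \<in> {\<lambda>x. k * f (c * x + d) |k f. smooth f}"
    using assms by (auto intro!: exI[of _ 1])
  fix g assume "g \<in> {\<lambda>x. k * f (c * x + d) |k f. smooth f}"
  then obtain k f where g: "g = (\<lambda>x. k * f (c * x + d))" and f: "smooth f" by blast
  show "\<exists>g'\<in>{\<lambda>x. k * f (c * x + d) |k f. smooth f}. \<forall>x. (g has_real_derivative g' x) (at x)"
  proof (rule bexI[of _ "\<lambda>x. (k * c) * deriv f (c * x + d)"])
    show "\<forall>x. (g has_real_derivative k * c * deriv f (c * x + d)) (at x)"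
      unfolding g
      by (auto intro!: derivative_eq_intros DERIV_chain2[OF smooth_has_derivative[OF f]])
    show "(\<lambda>x. k * c * deriv f (c * x + d)) \<in> {\<lambda>x. k * f (c * x + d) |k f. smooth f}"
      using smooth_deriv[OF f] by blast
  qed
qed

section \<open>A flat function and the bumps built from it\<close>

lemma poly_exp_tendsto_0: "((\<lambda>x. poly p x * exp (- x)) \<longlongrightarrow> 0) (at_top :: real filter)"
proof -
  have "((\<lambda>x. \<Sum>i\<le>degree p. coeff p i * (x ^ i / exp x)) \<longlongrightarrow> (\<Sum>i\<le>degree p. coeff p i * 0)) at_top"
    by (intro tendsto_intros tendsto_power_div_exp_0)
  also have "(\<lambda>x. \<Sum>i\<le>degree p. coeff p i * (x ^ i / exp x)) = (\<lambda>x. poly p x * exp (- x))"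
    by (simp add: poly_altdef sum_distrib_right exp_minus divide_inverse mult.assoc)
  finally show ?thesis by simp
qed

definition flat_exp :: "real \<Rightarrow> real" where
  "flat_exp x = (if x > 0 then exp (- (1 / x)) else 0)"

text \<open>All derivatives have the form p(1/x) exp(-1/x) for x > 0 and 0 elsewhere. With z = 1/x
  the chain rule turns p into z^2 (p - p'), the polynomial
  \<open>[:0, 0, 1:] * (p - pderiv p)\<close>. At 0 the difference quotient turns p into z p, and
  exp(-z) beats every polynomial.\<close>

lemma smooth_flat_exp: "smooth flat_exp"
proof -
  define F where "F p x = (if x > 0 then poly p (1 / x) * exp (- (1 / x)) else 0)" for p and x :: real
  have der: "(F p has_real_derivative F ([:0, 0, 1:] * (p - pderiv p)) x) (at x)" for p x
  proof -
    consider "x > 0" | "x < 0" | "x = 0" by linarith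
    then show ?thesis
    proof cases
      case 1
      have "((\<lambda>x. poly p (1 / x) * exp (- (1 / x))) has_real_derivative
          F ([:0, 0, 1:] * (p - pderiv p)) x) (at x)"
        using 1 unfolding F_def
        by (auto intro!: derivative_eq_intros DERIV_chain2[OF poly_DERIV]
          simp: field_simps power2_eq_square)
      then show ?thesis
        by (rule has_field_derivative_transform_within_open[of _ _ _ "{0<..}"])
          (use 1 in \<open>auto simp: F_def\<close>)
    next
      case 2
      have "((\<lambda>_. 0) has_real_derivative F ([:0, 0, 1:] * (p - pderiv p)) x) (at x)"
        using 2 by (simp add: F_def)
      then show ?thesis
        by (rule has_field_derivative_transform_within_open[of _ _ _ "{..<0}"])
          (use 2 in \<open>auto simp: F_def\<close>)
    next
      case 3
      have "((\<lambda>h. F p h / h) \<longlongrightarrow> 0) (at_right 0)"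
      proof -
        have "((\<lambda>h. poly ([:0, 1:] * p) (inverse h) * exp (- (inverse h))) \<longlongrightarrow> 0) (at_right 0)"
          by (rule filterlim_compose[OF poly_exp_tendsto_0 filterlim_inverse_at_top_right])
        then show ?thesis
          by (rule Lim_transform_eventually)
            (auto simp: eventually_at_filter F_def field_simps inverse_eq_divide)
      qed
      moreover have "((\<lambda>h. F p h / h) \<longlongrightarrow> 0) (at_left 0)"
        by (rule tendsto_eventually) (auto simp: eventually_at_filter F_def)
      ultimately have "((\<lambda>h. F p h / h) \<longlongrightarrow> 0) (at 0)"
        by (rule filterlim_split_at[rotated])
      then show ?thesis using 3 by (simp add: DERIV_def F_def)
    qed
  qed
  have "smooth (F [:1:])"
    by (rule smooth_coinduct[of _ "range F"]) (use der in blast)+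
  moreover have "F [:1:] = flat_exp" by (auto simp: F_def flat_exp_def)
  ultimately show ?thesis by simp
qed

text \<open>A positive steepness \<open>k\<close> leaves the support alone; letting it grow pushes
  the values inside towards 1.\<close>

definition bump :: "real \<Rightarrow> real \<Rightarrow> real \<Rightarrow> real \<Rightarrow> real" where
  "bump c d k x = flat_exp (k * (x - c)) * flat_exp (k * (d - x))"

lemma smooth_bump: "smooth (bump c d k)"
proof -
  have "smooth (\<lambda>x. flat_exp (k * x + (- k * c)) * flat_exp (- k * x + k * d))"
    by (intro smooth_mult smooth_affine smooth_flat_exp)
  moreover have "bump c d k = (\<lambda>x. flat_exp (k * x + (- k * c)) * flat_exp (- k * x + k * d))"
    by (auto simp: bump_def algebra_simps)
  ultimately show ?thesis by simp
qed

lemma flat_exp_bounds: "0 \<le> flat_exp x" "flat_exp x \<le> 1"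
  by (auto simp: flat_exp_def)

lemma bump_bounds: "0 \<le> bump c d k x" "bump c d k x \<le> 1"
  by (auto simp: bump_def flat_exp_bounds intro: mult_le_one)

lemma bump_eq_0: "k > 0 \<Longrightarrow> x \<notin> {c<..<d} \<Longrightarrow> bump c d k x = 0"
  by (auto simp: bump_def flat_exp_def zero_less_mult_iff)

lemma bump_pos: "k > 0 \<Longrightarrow> x \<in> {c<..<d} \<Longrightarrow> bump c d k x > 0"
  by (auto simp: bump_def flat_exp_def zero_less_mult_iff)

lemma bump_tendsto_1:
  assumes "x \<in> {c<..<d}"
  shows "(\<lambda>k. bump c d (real (Suc k)) x) \<longlonglongrightarrow> 1"
proof -
  have *: "(\<lambda>k. flat_exp (real (Suc k) * y)) \<longlonglongrightarrow> 1" if "y > 0" for y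
  proof -
    have "(\<lambda>k. exp (- (inverse (real (Suc k)) / y))) \<longlonglongrightarrow> exp (- (0 / y))"
      by (intro tendsto_intros LIMSEQ_inverse_real_of_nat) (use that in auto)
    then show ?thesis using that
      by (simp add: flat_exp_def inverse_eq_divide del: of_nat_Suc)
  qed
  show ?thesis
    unfolding bump_def
    using tendsto_mult[OF *[of "x - c"] *[of "d - x"]] assms by simp
qed

lemma test_functionsI:
  assumes "smooth \<phi>" "{c..d} \<subseteq> S" "\<And>x. x \<notin> {c..d} \<Longrightarrow> \<phi> x = 0"
  shows "\<phi> \<in> test_functions S"
proof -
  have "{x. \<phi> x \<noteq> 0} \<subseteq> {c..d}" using assms(3) by blast
  then have "closure {x. \<phi> x \<noteq> 0} \<subseteq> {c..d}" by (intro closure_minimal) auto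
  then show ?thesis
    using assms(1,2) bounded_subset[of "{c..d}"]
    by (auto simp: test_functions_def smooth_def compact_eq_bounded_closed)
qed

lemma test_functionsE:
  assumes "\<phi> \<in> test_functions {a<..<b::real}" "a < b"
  obtains c d where "smooth \<phi>" "a < c" "c < d" "d < b" "\<forall>x. x \<notin> {c..d} \<longrightarrow> \<phi> x = 0"
proof -
  let ?K = "closure {x. \<phi> x \<noteq> 0}"
  have K: "compact ?K" "?K \<subseteq> {a<..<b}" and sm: "smooth \<phi>"
    using assms by (auto simp: test_functions_def smooth_def)
  have zero: "\<phi> x = 0" if "x \<notin> ?K" for x
    using that closure_subset[of "{x. \<phi> x \<noteq> 0}"] by auto
  \<comment> \<open>The midpoint makes the compact set nonempty even for \<phi> = 0, so that it has
    a least and a greatest element.\<close>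
  define m where "m = (a + b) / 2"
  have m: "compact (insert m ?K)" "insert m ?K \<subseteq> {a<..<b}"
    using K assms(2) by (auto simp: m_def compact_insert)
  obtain c' where c': "c' \<in> insert m ?K" "\<And>x. x \<in> insert m ?K \<Longrightarrow> c' \<le> x"
    using compact_attains_inf[OF m(1)] by auto
  obtain d' where d': "d' \<in> insert m ?K" "\<And>x. x \<in> insert m ?K \<Longrightarrow> x \<le> d'"
    using compact_attains_sup[OF m(1)] by auto
  have "c' \<in> {a<..<b}" "d' \<in> {a<..<b}" using m(2) c'(1) d'(1) by (auto simp del: insert_iff)
  moreover have "c' \<le> d'" using c'(2)[OF d'(1)] .
  ultimately have ab: "a < c'" "c' \<le> d'" "d' < b" by auto
  \<comment> \<open>\<open>c'\<close> and \<open>d'\<close> may coincide, so the right end is moved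
    halfway to \<open>b\<close> to make \<open>c < d\<close> strict.\<close>
  show ?thesis
  proof (rule that[of "c'" "(d' + b) / 2"])
    have "\<phi> x = 0" if "x \<notin> {c'..(d' + b) / 2}" for x
      by (rule zero) (use that c' d' ab in force)
    then show "\<forall>x. x \<notin> {c'..(d' + b) / 2} \<longrightarrow> \<phi> x = 0" by blast
  qed (use sm ab in auto)
qed

lemma deriv_zero_outside:
  assumes "smooth \<phi>" "\<And>x. x \<notin> {c..d} \<Longrightarrow> \<phi> x = 0" "x \<notin> {c..d}"
  shows "deriv \<phi> x = 0"
proof -
  have "((\<lambda>_. 0) has_real_derivative 0) (at x)" by simp
  then have "(\<phi> has_real_derivative 0) (at x)"
    by (rule has_field_derivative_transform_within_open[of _ _ _ "- {c..d}"]) (use assms in auto)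
  then show ?thesis by (rule DERIV_imp_deriv)
qed

section \<open>Weak derivatives\<close>

lemma has_ac_deriv_indefinite_integral:
  assumes "f absolutely_integrable_on {a..b}"
  shows "has_ac_deriv (\<lambda>x. integral {a..x} f) f a b"
  unfolding has_ac_deriv_def
proof (intro conjI allI impI assms)
  fix s t assume st: "a \<le> s \<and> s \<le> t \<and> t \<le> b"
  have int: "f integrable_on {c..d}" if "{c..d} \<subseteq> {a..b}" for c d
    using absolutely_integrable_on_subinterval[OF assms that] set_lebesgue_integral_eq_integral(1) by blast
  have "integral {a..t} f = integral {a..s} f + integral {s..t} f"
    using Henstock_Kurzweil_Integration.integral_combine[of a s t f] st int[of a t] by auto
  then show "(f has_integral integral {a..t} f - integral {a..s} f) {s..t}"
    using int[of s t] st by (simp add: has_integral_integral)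
qed

lemma has_ac_deriv_smooth: "smooth \<phi> \<Longrightarrow> has_ac_deriv \<phi> (deriv \<phi>) a b"
  by (intro has_ac_deriv_C1 smooth_has_derivative smooth_continuous_on smooth_deriv)

lemma smooth_mult_absolutely_integrable:
  assumes "smooth \<phi>" "f absolutely_integrable_on {c..d}"
  shows "(\<lambda>x. \<phi> x * f x) absolutely_integrable_on {c..d}"
proof (rule absolutely_integrable_bounded_measurable_product_real[OF _ _ _ assms(2)])
  have "continuous_on {c..d} \<phi>" using assms(1) by (rule smooth_continuous_on)
  then show "\<phi> \<in> borel_measurable (lebesgue_on {c..d})" "bounded (\<phi> ` {c..d})"
    by (auto intro: continuous_imp_measurable_on_sets_lebesgue compact_imp_bounded compact_continuous_image)
qed auto

text \<open>Link between the two integrals in use: weak derivatives are stated with Lebesgue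
  integrals over an open set, the calculus of absolutely continuous functions with gauge integrals
  over closed intervals. Both see only the support of \<phi>.\<close>

lemma
  fixes f :: "real \<Rightarrow> real"
  assumes "smooth \<phi>" "\<And>x. x \<notin> {c..d} \<Longrightarrow> \<phi> x = 0" "{c..d} \<subseteq> S" "f absolutely_integrable_on {c..d}"
  shows compact_support_set_integrable: "set_integrable lebesgue S (\<lambda>x. \<phi> x * f x)"
    and compact_support_LINT: "(LINT x:S|lebesgue. \<phi> x * f x) = integral {c..d} (\<lambda>x. \<phi> x * f x)"
proof -
  have abs: "(\<lambda>x. \<phi> x * f x) absolutely_integrable_on {c..d}"
    using assms by (intro smooth_mult_absolutely_integrable)
  have eq: "(\<lambda>x. indicator S x *\<^sub>R (\<phi> x * f x)) = (\<lambda>x. indicator {c..d} x *\<^sub>R (\<phi> x * f x))"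
    using assms(2,3) by (auto simp: indicator_def fun_eq_iff)
  show "set_integrable lebesgue S (\<lambda>x. \<phi> x * f x)"
    using abs eq by (simp add: set_integrable_def)
  show "(LINT x:S|lebesgue. \<phi> x * f x) = integral {c..d} (\<lambda>x. \<phi> x * f x)"
    using set_lebesgue_integral_eq_integral(2)[OF abs] eq by (simp add: set_lebesgue_integral_def)
qed

lemma test_function_set_integrable:
  fixes f :: "real \<Rightarrow> real"
  assumes "locally_integrable {a<..<b} f" "\<phi> \<in> test_functions {a<..<b}" "a < b"
  shows "set_integrable lebesgue {a<..<b} (\<lambda>x. \<phi> x * f x)"
    and "set_integrable lebesgue {a<..<b} (\<lambda>x. deriv \<phi> x * f x)"
proof -
  obtain c d where cd: "smooth \<phi>" "a < c" "c < d" "d < b" "\<forall>x. x \<notin> {c..d} \<longrightarrow> \<phi> x = 0"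
    by (rule test_functionsE[OF assms(2,3)])
  then have sub: "{c..d} \<subseteq> {a<..<b}" by auto
  then have "f absolutely_integrable_on {c..d}"
    using assms(1) by (auto simp: locally_integrable_def)
  with cd sub show "set_integrable lebesgue {a<..<b} (\<lambda>x. \<phi> x * f x)"
    "set_integrable lebesgue {a<..<b} (\<lambda>x. deriv \<phi> x * f x)"
    by (auto intro!: compact_support_set_integrable[where c = c and d = d]
        smooth_deriv deriv_zero_outside[OF cd(1) cd(5)[rule_format]])
qed

section \<open>The fundamental lemma of the calculus of variations\<close>

lemma integral_zero_on_intervals_imp_negligible:
  fixes f :: "real \<Rightarrow> real"
  assumes "f integrable_on {a..b}" "\<And>c d. a < c \<Longrightarrow> c < d \<Longrightarrow> d < b \<Longrightarrow> integral {c..d} f = 0"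
  shows "negligible {x \<in> {a<..<b}. f x \<noteq> 0}"
proof -
  \<comment> \<open>Extension by zero makes the function integrable on every box, so that
    differentiation of integrals applies to it.\<close>
  define g where "g x = (if x \<in> {a..b} then f x else 0)" for x
  have gint: "g integrable_on cbox c d" for c d
  proof -
    have "g integrable_on UNIV"
      unfolding g_def using assms(1) by (simp only: integrable_restrict_UNIV)
    then show ?thesis
      by (rule integrable_on_subcbox) auto
  qed
  \<comment> \<open>Lebesgue differentiation: outside a null set the means over
    \<open>[x, x + h]\<close> converge to \<open>g x\<close>, but inside \<open>(a, b)\<close> they
    vanish for small \<open>h\<close>.\<close>
  from integrable_ccontinuous_explicit[OF gint] obtain N where N: "negligible N"
    "\<And>x e. x \<notin> N \<Longrightarrow> 0 < e \<Longrightarrow> \<exists>d>0. \<forall>h. 0 < h \<and> h < d \<longrightarrow>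
       norm (integral (cbox x (x + h *\<^sub>R One)) g /\<^sub>R h ^ DIM(real) - g x) < e"
    by metis
  have "f x = 0" if x: "x \<in> {a<..<b}" "x \<notin> N" for x
  proof (rule ccontr)
    assume "f x \<noteq> 0"
    then obtain d where d: "d > 0"
      "\<And>h. 0 < h \<Longrightarrow> h < d \<Longrightarrow> norm (integral {x..x + h} g / h - g x) < \<bar>f x\<bar>"
      using N(2)[OF x(2), of "\<bar>f x\<bar>"] by (auto simp: divide_inverse mult.commute)
    define h where "h = min (d / 2) ((b - x) / 2)"
    have h: "0 < h" "h < d" "x + h < b" using d x by (auto simp: h_def min_def field_simps)
    have "integral {x..x + h} g = integral {x..x + h} f"
      by (rule integral_cong) (use x h in \<open>auto simp: g_def\<close>)
    also have "\<dots> = 0" using assms(2) x h by auto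
    finally show False using d(2)[OF h(1,2)] x by (simp add: g_def)
  qed
  then show ?thesis by (intro negligible_subset[OF N(1)]) auto
qed

text \<open>The bumps on \<open>[c, d]\<close> increase to the indicator function of \<open>(c, d)\<close>.\<close>

lemma fundamental_lemma_calculus_of_variations:
  fixes h :: "real \<Rightarrow> real"
  assumes loc: "locally_integrable {a<..<b} h" and "a < b"
    and zero: "\<And>\<phi>. \<phi> \<in> test_functions {a<..<b} \<Longrightarrow> (LINT x:{a<..<b}|lebesgue. \<phi> x * h x) = 0"
  shows "negligible {x \<in> {a<..<b}. h x \<noteq> 0}"
proof -
  have habs: "h absolutely_integrable_on {c..d}" if "a < c" "d < b" for c d
    using loc that by (auto simp: locally_integrable_def dest!: spec[of _ "{c..d}"])
  have int0: "integral {c..d} h = 0" if cd: "a < c" "c < d" "d < b" for c d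
  proof -
    define \<psi> where "\<psi> k = bump c d (real (Suc k))" for k
    have sub: "{c..d} \<subseteq> {a<..<b}" using cd by auto
    have \<psi>0: "\<psi> k x = 0" if "x \<notin> {c..d}" for k x
      unfolding \<psi>_def by (rule bump_eq_0) (use that in auto)
    have sm: "smooth (\<psi> k)" for k by (simp add: \<psi>_def smooth_bump)
    have "integral {c<..<d} (\<lambda>x. \<psi> k x * h x) = 0" for k
    proof -
      have "\<psi> k \<in> test_functions {a<..<b}"
        by (rule test_functionsI[OF sm sub \<psi>0])
      from zero[OF this] show ?thesis
        using compact_support_LINT[OF sm[of k] \<psi>0 sub habs] cd by (simp add: integral_open_interval_real)
    qed
    moreover have "(\<lambda>k. integral {c<..<d} (\<lambda>x. \<psi> k x * h x)) \<longlonglongrightarrow> integral {c<..<d} h"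
    proof (rule dominated_convergence(2))
      show "(\<lambda>x. \<psi> k x * h x) integrable_on {c<..<d}" for k
        using smooth_mult_absolutely_integrable[OF sm habs] cd
        by (simp add: integrable_on_Icc_iff_Ioo[symmetric] set_lebesgue_integral_eq_integral(1))
      show "(\<lambda>x. \<bar>h x\<bar>) integrable_on {c<..<d}"
        using habs[of c d] cd
        by (simp add: integrable_on_Icc_iff_Ioo[symmetric] absolutely_integrable_on_def)
      show "norm (\<psi> k x * h x) \<le> \<bar>h x\<bar>" for k x
        using bump_bounds[of c d "real (Suc k)" x]
        by (simp add: \<psi>_def abs_mult mult_left_le_one_le del: of_nat_Suc)
      show "(\<lambda>k. \<psi> k x * h x) \<longlonglongrightarrow> h x" if "x \<in> {c<..<d}" for x
        using tendsto_mult_right[OF bump_tendsto_1[OF that], of "h x"] by (simp add: \<psi>_def del: of_nat_Suc)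
    qed
    ultimately have "integral {c<..<d} h = 0"
      by (simp add: LIMSEQ_const_iff)
    then show ?thesis by (simp add: integral_open_interval_real)
  qed
  \<comment> \<open>\<open>h\<close> is only locally integrable, so \<open>(a, b)\<close> is
    exhausted by countably many compact subintervals; the offset 3 keeps \<open>c n < d n\<close>
    from n = 0 on.\<close>
  define c d where "c n = a + (b - a) / real (n + 3)" and "d n = b - (b - a) / real (n + 3)" for n
  have cd: "a < c n" "d n < b" for n using \<open>a < b\<close> by (auto simp: c_def d_def)
  have "negligible (\<Union>n. {x \<in> {c n<..<d n}. h x \<noteq> 0})"
  proof (rule negligible_countable_Union)
    fix X assume "X \<in> range (\<lambda>n. {x \<in> {c n<..<d n}. h x \<noteq> 0})"
    then obtain n where X: "X = {x \<in> {c n<..<d n}. h x \<noteq> 0}" by blast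
    show "negligible X" unfolding X
    proof (rule integral_zero_on_intervals_imp_negligible)
      show "h integrable_on {c n..d n}"
        by (intro set_lebesgue_integral_eq_integral(1) habs cd)
      show "integral {c'..d'} h = 0" if "c n < c'" "c' < d'" "d' < d n" for c' d'
        by (rule int0) (use cd[of n] that in auto)
    qed
  qed auto
  then show ?thesis
  proof (rule negligible_subset, safe)
    fix x assume x: "x \<in> {a<..<b}" "h x \<noteq> 0"
    define m where "m = min (x - a) (b - x)"
    have m: "m > 0" "m \<le> x - a" "m \<le> b - x" using x by (auto simp: m_def)
    obtain n :: nat where n: "(b - a) / m < real n"
      using reals_Archimedean2 by blast
    have "(b - a) / real (n + 3) < m"
    proof -
      have "b - a < real n * m" using n m by (simp add: field_simps)
      also have "\<dots> \<le> real (n + 3) * m" using m by simp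
      finally show ?thesis by (simp add: field_simps)
    qed
    then have "x \<in> {c n<..<d n}" using m by (auto simp: c_def d_def)
    then show "x \<in> (\<Union>n. {x \<in> {c n<..<d n}. h x \<noteq> 0})" using x by blast
  qed
qed

lemma locally_integrableI:
  assumes "f absolutely_integrable_on {a..b}"
  shows "locally_integrable {a<..<b} f"
  unfolding locally_integrable_def
proof (intro allI impI, elim conjE)
  fix K assume "compact K" "K \<subseteq> {a<..<b}"
  then have "K \<in> sets lebesgue" "K \<subseteq> {a..b}"
    by (auto dest: lmeasurable_compact fmeasurableD)
  with assms show "f absolutely_integrable_on K"
    by (rule set_integrable_subset)
qed

text \<open>Integration by parts: the product rule for \<phi> times each component, integrated over
  \<open>[a, b]\<close>, has vanishing boundary terms because \<phi> is supported inside. Components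
  appear since \<open>has_ac_deriv\<close> is a notion for real functions.\<close>

lemma has_ac_deriv_imp_weak_deriv:
  fixes f :: "real \<Rightarrow> 'a::euclidean_space"
  assumes "a < b" and ac: "\<And>i. i \<in> Basis \<Longrightarrow> has_ac_deriv (\<lambda>x. f x \<bullet> i) (\<lambda>x. f' x \<bullet> i) a b"
  shows "has_weak_deriv {a<..<b} f f'"
  unfolding has_weak_deriv_def
proof (intro conjI ballI)
  have abs_fi: "(\<lambda>x. f x \<bullet> i) absolutely_integrable_on {a..b}" if "i \<in> Basis" for i
    by (rule absolutely_integrable_continuous_real[OF has_ac_deriv_continuous_on[OF ac[OF that]]])
  have abs_f'i: "(\<lambda>x. f' x \<bullet> i) absolutely_integrable_on {a..b}" if "i \<in> Basis" for i
    using ac[OF that] unfolding has_ac_deriv_def by (rule conjunct1)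
  have abs_f: "f absolutely_integrable_on {a..b}"
    by (rule absolutely_integrable_componentwise[OF abs_fi])
  then show "locally_integrable {a<..<b} f"
    by (rule locally_integrableI)
  have abs_f': "f' absolutely_integrable_on {a..b}"
    by (rule absolutely_integrable_componentwise[OF abs_f'i])
  then show "locally_integrable {a<..<b} f'"
    by (rule locally_integrableI)
  fix \<phi> assume "\<phi> \<in> test_functions {a<..<b}"
  then obtain c d where cd: "smooth \<phi>" "a < c" "c < d" "d < b" "\<forall>x. x \<notin> {c..d} \<longrightarrow> \<phi> x = 0"
    using \<open>a < b\<close> by (rule test_functionsE)
  show "(LINT x:{a<..<b}|lebesgue. deriv \<phi> x *\<^sub>R f x) = - (LINT x:{a<..<b}|lebesgue. \<phi> x *\<^sub>R f' x)"
  proof -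
    have comp: "(LINT x:{a<..<b}|lebesgue. \<psi> x *\<^sub>R g x) \<bullet> i = integral {a..b} (\<lambda>x. \<psi> x * (g x \<bullet> i))"
      if "smooth \<psi>" "g absolutely_integrable_on {a..b}" for \<psi> g and i :: 'a
    proof -
      have "(\<lambda>x. \<psi> x *\<^sub>R g x) absolutely_integrable_on {a..b}"
      proof (rule absolutely_integrable_componentwise)
        fix j :: 'a assume "j \<in> Basis"
        then have "(\<lambda>x. g x \<bullet> j) absolutely_integrable_on {a..b}"
          using that(2) by (intro absolutely_integrable_component)
        from smooth_mult_absolutely_integrable[OF that(1) this]
        show "(\<lambda>x. (\<psi> x *\<^sub>R g x) \<bullet> j) absolutely_integrable_on {a..b}" by simp
      qed
      then have *: "(\<lambda>x. \<psi> x *\<^sub>R g x) absolutely_integrable_on {a<..<b}"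
        by (simp add: absolutely_integrable_on_Icc_iff_Ioo)
      note ** = set_lebesgue_integral_eq_integral[OF this]
      have "(LINT x:{a<..<b}|lebesgue. \<psi> x *\<^sub>R g x) \<bullet> i = integral {a<..<b} (\<lambda>x. (\<psi> x *\<^sub>R g x) \<bullet> i)"
        unfolding **(2) by (rule integral_component_eq[OF **(1), symmetric])
      then show ?thesis by (simp add: integral_open_interval_real)
    qed
    have "integral {a..b} (\<lambda>x. deriv \<phi> x * (f x \<bullet> i)) = - integral {a..b} (\<lambda>x. \<phi> x * (f' x \<bullet> i))"
      if i: "i \<in> Basis" for i
    proof -
      have "has_ac_deriv (\<lambda>x. \<phi> x * (f x \<bullet> i)) (\<lambda>x. deriv \<phi> x * (f x \<bullet> i) + \<phi> x * (f' x \<bullet> i)) a b"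
        by (intro has_ac_deriv_mult has_ac_deriv_smooth cd ac i)
      then have "((\<lambda>x. deriv \<phi> x * (f x \<bullet> i) + \<phi> x * (f' x \<bullet> i)) has_integral
          \<phi> b * (f b \<bullet> i) - \<phi> a * (f a \<bullet> i)) {a..b}"
        using \<open>a < b\<close> by (simp add: has_ac_deriv_def)
      moreover have "\<phi> a = 0" "\<phi> b = 0" using cd by auto
      ultimately have "integral {a..b} (\<lambda>x. deriv \<phi> x * (f x \<bullet> i) + \<phi> x * (f' x \<bullet> i)) = 0"
        by (simp add: integral_unique)
      moreover have "integral {a..b} (\<lambda>x. deriv \<phi> x * (f x \<bullet> i) + \<phi> x * (f' x \<bullet> i)) =
        integral {a..b} (\<lambda>x. deriv \<phi> x * (f x \<bullet> i)) + integral {a..b} (\<lambda>x. \<phi> x * (f' x \<bullet> i))"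
      proof (intro Henstock_Kurzweil_Integration.integral_add set_lebesgue_integral_eq_integral(1)
          smooth_mult_absolutely_integrable smooth_deriv cd)
        show "(\<lambda>x. f x \<bullet> i) absolutely_integrable_on {a..b}" by (rule abs_fi[OF i])
        show "(\<lambda>x. f' x \<bullet> i) absolutely_integrable_on {a..b}" by (rule abs_f'i[OF i])
      qed
      ultimately show ?thesis by simp
    qed
    then show ?thesis
      unfolding euclidean_eq_iff[where 'a = 'a] inner_minus_left
        comp[OF cd(1) abs_f'] comp[OF smooth_deriv[OF cd(1)] abs_f] by blast
  qed
qed

section \<open>Components and uniqueness of weak derivatives\<close>

lemma has_weak_deriv_inner:
  fixes f :: "real \<Rightarrow> 'a::euclidean_space"
  assumes "has_weak_deriv {a<..<b} f f'" "i \<in> Basis" "a < b"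
  shows "has_weak_deriv {a<..<b} (\<lambda>x. f x \<bullet> i) (\<lambda>x. f' x \<bullet> i)"
proof -
  have loc: "locally_integrable {a<..<b} (\<lambda>x. g x \<bullet> j)"
    if "locally_integrable {a<..<b} g" "j \<in> Basis" for g and j :: 'a
    using that absolutely_integrable_component unfolding locally_integrable_def by blast
  have comp: "(LINT x:{a<..<b}|lebesgue. \<psi> x *\<^sub>R g x) \<bullet> i = (LINT x:{a<..<b}|lebesgue. \<psi> x *\<^sub>R (g x \<bullet> i))"
    if "\<And>j. j \<in> Basis \<Longrightarrow> set_integrable lebesgue {a<..<b} (\<lambda>x. \<psi> x * (g x \<bullet> j))"
    for \<psi> :: "real \<Rightarrow> real" and g :: "real \<Rightarrow> 'a"
  proof -
    have "set_integrable lebesgue {a<..<b} (\<lambda>x. \<psi> x *\<^sub>R g x)"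
      by (rule absolutely_integrable_componentwise) (use that in simp)
    then show ?thesis
      unfolding set_lebesgue_integral_def set_integrable_def
      by (subst integral_inner_left[symmetric]) (auto simp: mult.assoc)
  qed
  show ?thesis
    unfolding has_weak_deriv_def
  proof (intro conjI ballI)
    fix \<phi> assume \<phi>: "\<phi> \<in> test_functions {a<..<b}"
    have "(LINT x:{a<..<b}|lebesgue. deriv \<phi> x *\<^sub>R f x) \<bullet> i = (- (LINT x:{a<..<b}|lebesgue. \<phi> x *\<^sub>R f' x)) \<bullet> i"
      using assms(1) \<phi> by (simp add: has_weak_deriv_def)
    then show "(LINT x:{a<..<b}|lebesgue. deriv \<phi> x *\<^sub>R (f x \<bullet> i)) = - (LINT x:{a<..<b}|lebesgue. \<phi> x *\<^sub>R (f' x \<bullet> i))"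
      using assms(1) \<phi> \<open>a < b\<close> unfolding has_weak_deriv_def inner_minus_left
      by (subst (asm) (1 2) comp) (auto intro!: test_function_set_integrable loc)
  qed (use assms loc in \<open>auto simp: has_weak_deriv_def\<close>)
qed

lemma locally_integrable_diff:
  "locally_integrable S f \<Longrightarrow> locally_integrable S g \<Longrightarrow> locally_integrable S (\<lambda>x. f x - g x)"
  by (simp add: locally_integrable_def set_integral_diff(1))

lemma has_weak_deriv_diff:
  fixes f g :: "real \<Rightarrow> real"
  assumes "has_weak_deriv {a<..<b} f f'" "has_weak_deriv {a<..<b} g g'" "a < b"
  shows "has_weak_deriv {a<..<b} (\<lambda>x. f x - g x) (\<lambda>x. f' x - g' x)"
  using assms unfolding has_weak_deriv_def
  by (simp add: locally_integrable_diff right_diff_distrib set_integral_diff(2) test_function_set_integrable)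

lemma weak_deriv_unique_real:
  fixes f :: "real \<Rightarrow> real"
  assumes "has_weak_deriv {a<..<b} f f'" "has_weak_deriv {a<..<b} f g'" "a < b"
  shows "negligible {x \<in> {a<..<b}. f' x \<noteq> g' x}"
proof -
  have "has_weak_deriv {a<..<b} (\<lambda>x. f x - f x) (\<lambda>x. f' x - g' x)"
    by (rule has_weak_deriv_diff[OF assms])
  then have "negligible {x \<in> {a<..<b}. f' x - g' x \<noteq> 0}"
    using \<open>a < b\<close> by (intro fundamental_lemma_calculus_of_variations) (auto simp: has_weak_deriv_def)
  then show ?thesis by simp
qed

lemma weak_deriv_unique:
  fixes f :: "real \<Rightarrow> 'a::euclidean_space"
  assumes "has_weak_deriv {a<..<b} f f'" "has_weak_deriv {a<..<b} f g'" "a < b"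
  shows "negligible {x \<in> {a<..<b}. f' x \<noteq> g' x}"
proof -
  have "negligible (\<Union>i\<in>Basis. {x \<in> {a<..<b}. f' x \<bullet> i \<noteq> g' x \<bullet> i})"
  proof (intro negligible_Union finite_imageI finite_Basis)
    fix X assume "X \<in> (\<lambda>i. {x \<in> {a<..<b}. f' x \<bullet> i \<noteq> g' x \<bullet> i}) ` Basis"
    then obtain i where i: "i \<in> Basis" "X = {x \<in> {a<..<b}. f' x \<bullet> i \<noteq> g' x \<bullet> i}" by blast
    show "negligible X" unfolding i(2)
      by (rule weak_deriv_unique_real[OF assms(1,2)[THEN has_weak_deriv_inner, OF i(1) assms(3)] assms(3)])
  qed
  then show ?thesis
    by (rule negligible_subset) (auto simp: euclidean_eq_iff[where 'a = 'a])
qed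

text \<open>\<open>weak_deriv\<close> is an arbitrary choice, so values computed for one weak
  derivative carry over to it only by uniqueness, and only off a null set.\<close>

lemma weak_deriv_AE:
  fixes f :: "real \<Rightarrow> 'a::euclidean_space"
  assumes "has_weak_deriv {a<..<b} f f'" "a < b"
  shows "negligible {x \<in> {a<..<b}. weak_deriv {a<..<b} f x \<noteq> f' x}"
  unfolding weak_deriv_def
  by (rule weak_deriv_unique[OF someI[of "has_weak_deriv {a<..<b} f", OF assms(1)] assms])

lemma continuous_antiderivative:
  fixes g :: "real \<Rightarrow> real"
  assumes "continuous_on UNIV g"
  obtains F where "\<And>x. (F has_real_derivative g x) (at x)"
proof -
  have "\<exists>F. \<forall>x. - \<infinity> < ereal x \<longrightarrow> ereal x < \<infinity> \<longrightarrow> (F has_vector_derivative g x) (at x)"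
    using assms by (intro einterval_antiderivative) (auto simp: continuous_on_eq_continuous_at)
  then show ?thesis
    using that by (auto simp: has_real_derivative_iff_has_vector_derivative)
qed

text \<open>
  Every test function minus a suitable multiple of one fixed bump has integral zero, hence is the
  derivative of a test function.
\<close>

lemma du_bois_reymond:
  fixes f :: "real \<Rightarrow> real"
  assumes weak: "has_weak_deriv {a<..<b} f (\<lambda>_. 0)" and "a < b"
  obtains C where "negligible {x \<in> {a<..<b}. f x \<noteq> C}"
proof -
  define p q where "p = (2 * a + b) / 3" and "q = (a + 2 * b) / 3"
  have pq: "a < p" "p < q" "q < b" using \<open>a < b\<close> by (auto simp: p_def q_def)
  define \<psi> where "\<psi> = bump p q 1"
  have \<psi>0: "\<psi> x = 0" if "x \<notin> {p..q}" for x
    using bump_eq_0[of 1 x p q] that by (auto simp: \<psi>_def)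
  have sm_\<psi>: "smooth \<psi>" by (simp add: \<psi>_def smooth_bump)
  have int: "g integrable_on {a..b}" if "smooth g" for g
    by (rule integrable_continuous_real) (use that smooth_continuous_on in blast)
  define I where "I = integral {a..b} \<psi>"
  have "I \<noteq> 0"
  proof
    assume "I = 0"
    then have "\<forall>x\<in>{a..b}. \<psi> x = 0"
      unfolding I_def using \<open>a < b\<close> smooth_continuous_on[OF sm_\<psi>]
      by (subst (asm) integral_eq_0_iff) (auto simp: \<psi>_def bump_bounds)
    moreover have "\<psi> ((p + q) / 2) > 0"
      unfolding \<psi>_def by (rule bump_pos) (use pq in auto)
    ultimately show False using pq by (auto dest!: bspec[of _ _ "(p + q) / 2"])
  qed
  have loc: "locally_integrable {a<..<b} f"
    using weak by (simp add: has_weak_deriv_def)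
  \<comment> \<open>If \<open>f\<close> is constant almost everywhere, testing with \<psi> forces
    this value.\<close>
  define C where "C = (LINT x:{a<..<b}|lebesgue. \<psi> x * f x) / I"
  have \<psi>_test: "\<psi> \<in> test_functions {a<..<b}"
    by (rule test_functionsI[OF sm_\<psi> _ \<psi>0]) (use pq in auto)
  have "negligible {x \<in> {a<..<b}. f x - C \<noteq> 0}"
  proof (rule fundamental_lemma_calculus_of_variations[OF _ \<open>a < b\<close>])
    have locC: "locally_integrable {a<..<b} (\<lambda>_. C)"
      by (intro locally_integrableI absolutely_integrable_continuous_real continuous_on_const)
    show "locally_integrable {a<..<b} (\<lambda>x. f x - C)"
      by (intro locally_integrable_diff loc locC)
    fix \<eta> assume \<eta>: "\<eta> \<in> test_functions {a<..<b}"
    then obtain c d where cd: "smooth \<eta>" "a < c" "c < d" "d < b" "\<forall>x. x \<notin> {c..d} \<longrightarrow> \<eta> x = 0"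
      using \<open>a < b\<close> by (rule test_functionsE)
    define J where "J = integral {a..b} \<eta>"
    define g where "g x = \<eta> x - J / I * \<psi> x" for x
    have sm_g: "smooth g"
      unfolding g_def by (rule smooth_diff_cmult[OF cd(1) sm_\<psi>])
    obtain G where G: "\<And>x. (G has_real_derivative g x) (at x)"
      using continuous_antiderivative[OF smooth_continuous_on[OF sm_g]] by blast
    define \<Phi> where "\<Phi> x = G x - G a" for x
    have \<Phi>: "(\<Phi> has_real_derivative g x) (at x)" for x
      unfolding \<Phi>_def by (auto intro!: derivative_eq_intros G)
    have gint: "(g has_integral (\<Phi> t - \<Phi> s)) {s..t}" if "s \<le> t" for s t
      using has_ac_deriv_C1[OF \<Phi> smooth_continuous_on[OF sm_g], of s t] that by (simp add: has_ac_deriv_def)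
    \<comment> \<open>The hull of the supports of \<eta> and \<psi>. Outside it \<open>g\<close>
      vanishes, so \<Phi> is constant on either side: 0 on the left by normalisation, 0 on the right
      because \<open>g\<close> has integral zero.\<close>
    define m M where "m = min c p" and "M = max d q"
    have mM: "a < m" "M < b" "m < M" using cd pq by (auto simp: m_def M_def)
    have g0: "g x = 0" if "x \<notin> {m..M}" for x
    proof -
      have "x \<notin> {c..d}" "x \<notin> {p..q}" using that by (auto simp: m_def M_def)
      then show ?thesis using cd(5) \<psi>0 by (simp add: g_def)
    qed
    have \<Phi>_const: "\<Phi> t = \<Phi> s" if "s \<le> t" "t < m \<or> M < s" for s t
    proof -
      have "(g has_integral 0) {s..t}"
        by (rule has_integral_is_0) (use that g0 in auto)
      with gint[OF that(1)] have "\<Phi> t - \<Phi> s = 0" by (rule has_integral_unique)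
      then show ?thesis by simp
    qed
    have \<Phi>a: "\<Phi> a = 0" by (simp add: \<Phi>_def)
    have \<Phi>b: "\<Phi> b = 0"
    proof -
      have "((\<lambda>x. \<eta> x - J / I * \<psi> x) has_integral (J - J / I * I)) {a..b}"
        unfolding J_def I_def
        by (intro has_integral_diff has_integral_mult_right integrable_integral int cd sm_\<psi>)
      then have "(g has_integral 0) {a..b}"
        using \<open>I \<noteq> 0\<close> by (simp add: g_def[abs_def])
      from has_integral_unique[OF gint this] \<open>a < b\<close> \<Phi>a show ?thesis by simp
    qed
    have \<Phi>0: "\<Phi> x = 0" if "x \<notin> {m..M}" for x
    proof (cases "x < m")
      case True then show ?thesis
        using \<Phi>_const[of a x] \<Phi>_const[of x a] \<Phi>a mM by (cases "a \<le> x") auto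
    next
      case False then show ?thesis
        using \<Phi>_const[of b x] \<Phi>_const[of x b] \<Phi>b mM that by (cases "b \<le> x") auto
    qed
    have "\<Phi> \<in> test_functions {a<..<b}"
      by (rule test_functionsI[OF smooth_antiderivative[OF \<Phi> sm_g] _ \<Phi>0]) (use mM in auto)
    moreover have "deriv \<Phi> = g" using \<Phi> by (auto intro: DERIV_imp_deriv)
    ultimately have "(LINT x:{a<..<b}|lebesgue. g x * f x) = 0"
      using weak by (auto simp: has_weak_deriv_def dest!: bspec[of _ _ \<Phi>])
    moreover have "(LINT x:{a<..<b}|lebesgue. g x * f x) =
        (LINT x:{a<..<b}|lebesgue. \<eta> x * f x) - (LINT x:{a<..<b}|lebesgue. J / I * (\<psi> x * f x))"
      unfolding g_def left_diff_distrib mult.assoc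
      using \<open>a < b\<close> loc \<eta> \<psi>_test
      by (intro set_integral_diff(2) set_integrable_mult_right test_function_set_integrable) auto
    ultimately have 1: "(LINT x:{a<..<b}|lebesgue. \<eta> x * f x) = J * C"
      by (simp add: C_def)
    have "(LINT x:{a<..<b}|lebesgue. \<eta> x * C) = integral {c..d} (\<lambda>x. \<eta> x * C)"
      by (rule compact_support_LINT) (use cd in \<open>auto simp: absolutely_integrable_continuous_real\<close>)
    also have "\<dots> = integral {c..d} \<eta> * C" by simp
    also have "integral {c..d} \<eta> = J"
      unfolding J_def
    proof (rule integral_spike_set)
      show "negligible {x \<in> {c..d} - {a..b}. \<eta> x \<noteq> 0}" "negligible {x \<in> {a..b} - {c..d}. \<eta> x \<noteq> 0}"
        using cd by (auto intro: negligible_subset[OF negligible_empty])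
    qed
    finally have 2: "(LINT x:{a<..<b}|lebesgue. \<eta> x * C) = J * C" .
    show "(LINT x:{a<..<b}|lebesgue. \<eta> x * (f x - C)) = 0"
      unfolding right_diff_distrib
      using set_integral_diff(2)[OF test_function_set_integrable(1)[OF loc \<eta> \<open>a < b\<close>]
          test_function_set_integrable(1)[OF locC \<eta> \<open>a < b\<close>]]
      unfolding 1 2 by simp
  qed
  then show ?thesis using that[of C] by simp
qed

text \<open>The indefinite integral \<open>F\<close> of \<open>f'\<close> has the weak derivative
  \<open>f'\<close> too, so \<open>f - F\<close> has weak derivative zero and is constant almost
  everywhere.\<close>

lemma weak_deriv_imp_ac_deriv:
  fixes f :: "real \<Rightarrow> real"
  assumes weak: "has_weak_deriv {a<..<b} f f'" and f': "f' absolutely_integrable_on {a<..<b}" and "a < b"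
  obtains g where "has_ac_deriv g f' a b" "negligible {x \<in> {a<..<b}. f x \<noteq> g x}"
proof -
  define F where "F x = integral {a..x} f'" for x
  have F: "has_ac_deriv F f' a b"
    unfolding F_def using f'
    by (intro has_ac_deriv_indefinite_integral) (simp add: absolutely_integrable_on_Icc_iff_Ioo)
  have "has_weak_deriv {a<..<b} F f'"
    using has_ac_deriv_imp_weak_deriv[OF \<open>a < b\<close>, of F f'] F by simp
  from has_weak_deriv_diff[OF weak this \<open>a < b\<close>]
  have "has_weak_deriv {a<..<b} (\<lambda>x. f x - F x) (\<lambda>_. 0)" by simp
  then obtain C where C: "negligible {x \<in> {a<..<b}. f x - F x \<noteq> C}"
    using du_bois_reymond \<open>a < b\<close> by blast
  have "has_ac_deriv (\<lambda>x. F x + C) f' a b"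
    using has_ac_deriv_add[OF F has_ac_deriv_const[of C]] by simp
  moreover have "negligible {x \<in> {a<..<b}. f x \<noteq> F x + C}"
    by (rule negligible_subset[OF C]) auto
  ultimately show ?thesis by (rule that)
qed

section \<open>Curves of class $W^{2,2}$ and their energy\<close>

lemma has_ac_deriv_spike:
  assumes "has_ac_deriv f f' a b" "negligible {x \<in> {a<..<b}. f' x \<noteq> g' x}"
  shows "has_ac_deriv f g' a b"
proof -
  define N where "N = {x \<in> {a<..<b}. f' x \<noteq> g' x} \<union> {a, b}"
  have N: "negligible N" using assms(2) by (simp add: N_def)
  have eq: "g' x = f' x" if "x \<in> {a..b} - N" for x
    using that by (cases "x = a \<or> x = b") (auto simp: N_def)
  show ?thesis
    unfolding has_ac_deriv_def
  proof (intro conjI allI impI)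
    show "g' absolutely_integrable_on {a..b}"
      by (rule absolutely_integrable_spike[OF _ N eq]) (use assms(1) in \<open>auto simp: has_ac_deriv_def\<close>)
    fix s t assume st: "a \<le> s \<and> s \<le> t \<and> t \<le> b"
    then have "(f' has_integral f t - f s) {s..t}"
      using assms(1) by (simp add: has_ac_deriv_def)
    then show "(g' has_integral f t - f s) {s..t}"
      by (rule has_integral_spike[OF N, rotated]) (use eq st in auto)
  qed
qed

lemma has_ac_deriv_imp_has_vector_derivative:
  assumes ac: "has_ac_deriv f f' a b" and "continuous_on {a..b} f'" "x \<in> {a..b}"
  shows "(f has_vector_derivative f' x) (at x within {a..b})"
proof -
  have "((\<lambda>t. f a + integral {a..t} f') has_vector_derivative 0 + f' x) (at x within {a..b})"
    by (intro derivative_intros integral_has_vector_derivative assms)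
  moreover have "f a + integral {a..t} f' = f t" if "t \<in> {a..b}" for t
  proof -
    have "(f' has_integral (f t - f a)) {a..t}" using ac that by (simp add: has_ac_deriv_def)
    then show ?thesis by (simp add: integral_unique)
  qed
  ultimately show ?thesis
    by (intro has_vector_derivative_transform[OF assms(3), of f "\<lambda>t. f a + integral {a..t} f'"]) simp_all
qed

text \<open>The function |f - g| is continuous and nonnegative and has integral zero.\<close>

lemma continuous_eq_if_AE_eq:
  fixes f g :: "real \<Rightarrow> real"
  assumes "continuous_on {a..b} f" "continuous_on {a..b} g" "a < b"
    and "negligible {x \<in> {a<..<b}. f x \<noteq> g x}" "x \<in> {a..b}"
  shows "f x = g x"
proof -
  have "negligible ({x \<in> {a<..<b}. f x \<noteq> g x} \<union> {a, b})" using assms(4) by simp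
  then have "integral {a..b} (\<lambda>x. \<bar>f x - g x\<bar>) = integral {a..b} (\<lambda>x. 0)"
    by (rule integral_spike) auto
  then have "integral {a..b} (\<lambda>x. \<bar>f x - g x\<bar>) = 0" by simp
  then have "\<forall>x\<in>{a..b}. \<bar>f x - g x\<bar> = 0"
    using assms(1-3) by (subst (asm) integral_eq_0_iff) (auto intro!: continuous_intros)
  then show ?thesis using assms(5) by auto
qed

text \<open>On a bounded interval constants are integrable, and t \<le> 1 + t^2.\<close>

lemma L2_imp_absolutely_integrable:
  fixes f :: "real \<Rightarrow> 'a::euclidean_space"
  assumes "f \<in> L2 {a<..<b}"
  shows "f absolutely_integrable_on {a<..<b}"
proof (rule measurable_bounded_by_integrable_imp_absolutely_integrable)
  show "f \<in> borel_measurable (lebesgue_on {a<..<b})"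
    using assms by (simp add: L2_def set_borel_measurable_def borel_measurable_restrict_space_iff)
  have "(\<lambda>x. (norm (f x))\<^sup>2) integrable_on {a<..<b}"
    using assms by (auto simp: L2_def set_lebesgue_integral_eq_integral(1))
  then show "(\<lambda>x. 1 + (norm (f x))\<^sup>2) integrable_on {a<..<b}"
    by (intro integrable_add) (auto simp: integrable_on_Icc_iff_Ioo[symmetric])
  show "norm (f x) \<le> 1 + (norm (f x))\<^sup>2" for x
    using sum_squares_ge_zero[of "norm (f x) - 1" 0] by (simp add: power2_eq_square algebra_simps)
      (smt (verit) norm_ge_zero zero_le_square)
qed auto

text \<open>Both weak derivatives are lifted to absolutely continuous functions: \<open>v\<close>
  represents \<open>u'\<close>, and the representative of \<open>u\<close> is \<open>u\<close>
  itself by continuity. Exchanging \<open>u'\<close> for \<open>v\<close>, which differs from it on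
  a null set, makes the first derivative continuous.\<close>

lemma W22_component:
  fixes u u' u'' :: "real \<Rightarrow> real"
  assumes cont: "continuous_on {0..1} u"
    and weak: "has_weak_deriv {0<..<1} u u'" "has_weak_deriv {0<..<1} u' u''"
    and abs: "u' absolutely_integrable_on {0<..<1}" "u'' absolutely_integrable_on {0<..<1}"
  obtains v where "has_ac_deriv u v 0 1" "has_ac_deriv v u'' 0 1"
proof -
  obtain v where v: "has_ac_deriv v u'' 0 1" "negligible {x \<in> {0<..<1}. u' x \<noteq> v x}"
    using weak_deriv_imp_ac_deriv[OF weak(2) abs(2)] by auto
  obtain w where w: "has_ac_deriv w u' 0 1" "negligible {x \<in> {0<..<1}. u x \<noteq> w x}"
    using weak_deriv_imp_ac_deriv[OF weak(1) abs(1)] by auto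
  have "w x = u x" if "x \<in> {0..1}" for x
    using continuous_eq_if_AE_eq[OF cont has_ac_deriv_continuous_on[OF w(1)] _ w(2) that] by simp
  then have "has_ac_deriv u u' 0 1" by (rule has_ac_deriv_cong[OF w(1)]) simp_all
  then have "has_ac_deriv u v 0 1" by (rule has_ac_deriv_spike[OF _ v(2)])
  then show ?thesis using v(1) by (rule that)
qed

lemma Basis_real2_iff: "i \<in> Basis \<longleftrightarrow> i = axis 1 1 \<or> i = axis 2 (1::real)" for i :: "real^2"
  by (auto simp: Basis_vec_def exhaust_2) (metis exhaust_2)

text \<open>Since \<open>p\<close> and \<open>q\<close> are continuous, the derivative in the
  integral sense is the classical one, one-sided at 0 and 1. This ties the representatives to
  \<open>dx\<close>.\<close>

lemma W22_real2:
  fixes u :: "real \<Rightarrow> real^2"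
  assumes "u \<in> W22"
  obtains p q g h where
    "has_ac_deriv (\<lambda>t. u t $ 1) p 0 1" "has_ac_deriv (\<lambda>t. u t $ 2) q 0 1"
    "has_ac_deriv p g 0 1" "has_ac_deriv q h 0 1"
    "\<And>t. t \<in> {0..1} \<Longrightarrow> dx u t = vector [p t, q t]"
proof -
  obtain u' u'' where u: "continuous_on {0..1} u" "u' \<in> L2 {0<..<1}" "u'' \<in> L2 {0<..<1}"
    "has_weak_deriv {0<..<1} u u'" "has_weak_deriv {0<..<1} u' u''"
    using assms by (auto simp: W22_def)
  have comp: "\<exists>v. has_ac_deriv (\<lambda>t. u t \<bullet> i) v 0 1 \<and> has_ac_deriv v (\<lambda>t. u'' t \<bullet> i) 0 1"
    if i: "i \<in> Basis" for i
  proof -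
    obtain v where "has_ac_deriv (\<lambda>t. u t \<bullet> i) v 0 1" "has_ac_deriv v (\<lambda>t. u'' t \<bullet> i) 0 1"
    proof (rule W22_component)
      show "continuous_on {0..1} (\<lambda>t. u t \<bullet> i)" by (intro continuous_intros u)
      show "has_weak_deriv {0<..<1} (\<lambda>t. u t \<bullet> i) (\<lambda>t. u' t \<bullet> i)"
        "has_weak_deriv {0<..<1} (\<lambda>t. u' t \<bullet> i) (\<lambda>t. u'' t \<bullet> i)"
        by (auto intro!: has_weak_deriv_inner u i)
      show "(\<lambda>t. u' t \<bullet> i) absolutely_integrable_on {0<..<1}"
        "(\<lambda>t. u'' t \<bullet> i) absolutely_integrable_on {0<..<1}"
        by (intro absolutely_integrable_component L2_imp_absolutely_integrable u)+
    qed
    then show ?thesis by blast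
  qed
  obtain p where p: "has_ac_deriv (\<lambda>t. u t $ 1) p 0 1" "has_ac_deriv p (\<lambda>t. u'' t $ 1) 0 1"
    using comp[of "axis 1 1"] by (auto simp: Basis_real2_iff inner_axis)
  obtain q where q: "has_ac_deriv (\<lambda>t. u t $ 2) q 0 1" "has_ac_deriv q (\<lambda>t. u'' t $ 2) 0 1"
    using comp[of "axis 2 1"] by (auto simp: Basis_real2_iff inner_axis)
  have "dx u t = vector [p t, q t]" if t: "t \<in> {0..1}" for t
  proof -
    have "((\<lambda>t. (u t $ 1) *\<^sub>R axis 1 1 + (u t $ 2) *\<^sub>R axis 2 1) has_vector_derivative
        (p t *\<^sub>R axis 1 1 + q t *\<^sub>R axis 2 1 :: real^2)) (at t within {0..1})"
      using has_ac_deriv_imp_has_vector_derivative[OF p(1) has_ac_deriv_continuous_on[OF p(2)] t]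
        has_ac_deriv_imp_has_vector_derivative[OF q(1) has_ac_deriv_continuous_on[OF q(2)] t]
      by (intro has_vector_derivative_add)
        (auto intro!: bounded_linear.has_vector_derivative[OF bounded_linear_scaleR_left])
    also have "(\<lambda>t. (u t $ 1) *\<^sub>R axis 1 1 + (u t $ 2) *\<^sub>R axis 2 1) = u"
      by (auto simp: fun_eq_iff vec_eq_iff forall_2 axis_def)
    also have "p t *\<^sub>R axis 1 1 + q t *\<^sub>R axis 2 1 = (vector [p t, q t] :: real^2)"
      by (auto simp: vec_eq_iff forall_2 axis_def)
    finally show ?thesis
      unfolding dx_def using t by (intro vector_derivative_within_closed_interval) auto
  qed
  with p q show ?thesis by (intro that)
qed

text \<open>Curvature with respect to the normal (-q, p): the conformal metric multiplies the
  Euclidean curvature by \<open>y\<close> and adds p / |(p, q)| from the derivative of the conformal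
  factor. A horizontal line run to the right, a horocycle, gets the value 1.\<close>

definition signed_curvature :: "real \<Rightarrow> real \<Rightarrow> real \<Rightarrow> real \<Rightarrow> real \<Rightarrow> real" where
  "signed_curvature y p q g h =
     p / sqrt (p\<^sup>2 + q\<^sup>2) + y * (p * h - q * g) / (sqrt (p\<^sup>2 + q\<^sup>2)) ^ 3"

definition energy_density :: "real \<Rightarrow> real \<Rightarrow> real \<Rightarrow> real \<Rightarrow> real \<Rightarrow> real" where
  "energy_density y p q g h = (signed_curvature y p q g h)\<^sup>2 * (sqrt (p\<^sup>2 + q\<^sup>2) / y)"

text \<open>The unit tangent \<open>ds u\<close> is absolutely continuous, so its weak derivative is
  given by the quotient rule up to a null set. With the Christoffel terms added, only a normal
  vector remains, and its hyperbolic length is the absolute value of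
  \<open>signed_curvature\<close>.\<close>

lemma elastic_energy_eq:
  fixes u :: "real \<Rightarrow> real^2"
  assumes ac: "has_ac_deriv (\<lambda>t. u t $ 1) p 0 1" "has_ac_deriv (\<lambda>t. u t $ 2) q 0 1"
    "has_ac_deriv p g 0 1" "has_ac_deriv q h 0 1"
    and dx: "\<And>t. t \<in> {0..1} \<Longrightarrow> dx u t = vector [p t, q t]"
    and pos: "\<And>t. t \<in> {0..1} \<Longrightarrow> u t $ 2 > 0" and imm: "\<And>t. t \<in> {0..1} \<Longrightarrow> (p t)\<^sup>2 + (q t)\<^sup>2 > 0"
  shows "elastic_energy u = (\<integral>\<^sup>+t\<in>{0..1}. ennreal (energy_density (u t $ 2) (p t) (q t) (g t) (h t)) \<partial>lebesgue)"
proof -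
  define y where "y t = u t $ 2" for t
  define n where "n t = sqrt ((p t)\<^sup>2 + (q t)\<^sup>2)" for t
  have y: "y t > 0" and n: "n t > 0" "(n t)\<^sup>2 = (p t)\<^sup>2 + (q t)\<^sup>2" if "t \<in> {0..1}" for t
    using pos[OF that] imm[OF that] by (auto simp: y_def n_def)
  have speed: "speed u t = n t / y t" if "t \<in> {0..1}" for t
    using y[OF that]
    by (simp add: speed_def hyp_norm_def hyp_metric_def dx[OF that] n_def y_def inner_vec_def sum_2
        real_sqrt_divide power2_eq_square[symmetric])
  have ds: "ds u t = vector [p t * y t / n t, q t * y t / n t]" if "t \<in> {0..1}" for t
    by (simp add: ds_def speed[OF that] dx[OF that] vec_eq_iff forall_2 field_simps)
  define T1 where "T1 t = (g t * y t + p t * q t) / n t - p t * y t * (p t * g t + q t * h t) / n t ^ 3" for t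
  define T2 where "T2 t = (h t * y t + q t * q t) / n t - q t * y t * (p t * g t + q t * h t) / n t ^ 3" for t
  have ac_n: "has_ac_deriv n (\<lambda>t. (p t * g t + q t * h t) / n t) 0 1"
  proof -
    have "has_ac_deriv (\<lambda>t. sqrt (p t * p t + q t * q t))
      (\<lambda>t. (g t * p t + p t * g t + (h t * q t + q t * h t)) / (2 * sqrt (p t * p t + q t * q t))) 0 1"
      by (intro has_ac_deriv_sqrt has_ac_deriv_add has_ac_deriv_mult ac)
        (use imm in \<open>auto simp: power2_eq_square\<close>)
    then show ?thesis
      by (rule has_ac_deriv_cong) (auto simp: n_def power2_eq_square divide_simps algebra_simps)
  qed
  have ac_y: "has_ac_deriv y q 0 1" using ac(2) by (simp add: y_def[abs_def])
  have "has_ac_deriv (\<lambda>t. (p t * y t) / n t)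
      (\<lambda>t. ((g t * y t + p t * q t) * n t - (p t * y t) * ((p t * g t + q t * h t) / n t)) / (n t)\<^sup>2) 0 1"
    by (intro has_ac_deriv_divide has_ac_deriv_mult ac ac_n ac_y) (use n(1) in force)
  then have ac1: "has_ac_deriv (\<lambda>t. ds u t $ 1) T1 0 1"
  proof (rule has_ac_deriv_cong)
    show "((g t * y t + p t * q t) * n t - (p t * y t) * ((p t * g t + q t * h t) / n t)) / (n t)\<^sup>2 = T1 t"
      if "t \<in> {0..1}" for t
      using n(1)[OF that] by (simp add: T1_def field_simps power2_eq_square power3_eq_cube)
  qed (simp add: ds)
  have "has_ac_deriv (\<lambda>t. (q t * y t) / n t)
      (\<lambda>t. ((h t * y t + q t * q t) * n t - (q t * y t) * ((p t * g t + q t * h t) / n t)) / (n t)\<^sup>2) 0 1"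
    by (intro has_ac_deriv_divide has_ac_deriv_mult ac ac_n ac_y) (use n(1) in force)
  then have ac2: "has_ac_deriv (\<lambda>t. ds u t $ 2) T2 0 1"
  proof (rule has_ac_deriv_cong)
    show "((h t * y t + q t * q t) * n t - (q t * y t) * ((p t * g t + q t * h t) / n t)) / (n t)\<^sup>2 = T2 t"
      if "t \<in> {0..1}" for t
      using n(1)[OF that] by (simp add: T2_def field_simps power2_eq_square power3_eq_cube)
  qed (simp add: ds)
  have "has_weak_deriv {0<..<1} (ds u) (\<lambda>t. vector [T1 t, T2 t] :: real^2)"
    by (rule has_ac_deriv_imp_weak_deriv) (use ac1 ac2 in \<open>auto simp: Basis_real2_iff inner_axis\<close>)
  then have neg: "negligible {t \<in> {0<..<1}. weak_deriv {0<..<1} (ds u) t \<noteq> vector [T1 t, T2 t]}" (is "negligible ?Z")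
    by (rule weak_deriv_AE) simp
  have eq: "(hyp_norm (u t) (curvature u t))\<^sup>2 * speed u t = energy_density (u t $ 2) (p t) (q t) (g t) (h t)"
    if t: "t \<in> {0..1}" "t \<noteq> 0" "t \<noteq> 1" "t \<notin> ?Z" for t
  proof -
    have w: "weak_deriv {0<..<1} (ds u) t = vector [T1 t, T2 t]" using t by auto
    define k where "k = signed_curvature (y t) (p t) (q t) (g t) (h t)"
    have k: "k = p t / n t + y t * (p t * h t - q t * g t) / n t ^ 3"
      by (simp add: k_def signed_curvature_def n_def)
    have y0: "y t > 0" and n0: "n t > 0" and n2: "n t * n t = p t * p t + q t * q t"
      using y n t(1) by (auto simp: power2_eq_square)
    \<comment> \<open>The covariant derivative of the unit tangent is \<open>k\<close> times (-q,
      p). Multiplication by \<open>n ^ 3\<close> clears the denominators and leaves the root only in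
      \<open>n * n\<close>, which \<open>n2\<close> replaces.\<close>
    have c1: "T1 t - (p t * y t / n t * q t + q t * y t / n t * p t) / y t = - q t * k"
    proof -
      have "(T1 t - (p t * y t / n t * q t + q t * y t / n t * p t) / y t + q t * k) * n t ^ 3 =
         g t * y t * (n t * n t) - p t * y t * (p t * g t + q t * h t) + q t * y t * (p t * h t - q t * g t)"
        using y0 n0 by (simp add: T1_def k field_simps power3_eq_cube)
      also have "\<dots> = 0" unfolding n2 by (simp add: algebra_simps)
      finally show ?thesis using n0 by simp
    qed
    have c2: "T2 t + (p t * y t / n t * p t - q t * y t / n t * q t) / y t = p t * k"
    proof -
      have "(T2 t + (p t * y t / n t * p t - q t * y t / n t * q t) / y t - p t * k) * n t ^ 3 =
         h t * y t * (n t * n t) - q t * y t * (p t * g t + q t * h t) - p t * y t * (p t * h t - q t * g t)"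
        using y0 n0 by (simp add: T2_def k field_simps power3_eq_cube)
      also have "\<dots> = 0" unfolding n2 by (simp add: algebra_simps)
      finally show ?thesis using n0 by simp
    qed
    have curv: "curvature u t = vector [- q t * k, p t * k] /\<^sub>R (n t / y t)"
      unfolding curvature_def cov_ds_def cov_dx_def Let_def w dx[OF t(1)] ds[OF t(1)] speed[OF t(1)]
      using c1 c2 by (simp add: y_def)
    have "(hyp_norm (u t) (curvature u t))\<^sup>2 = hyp_metric (u t) (curvature u t) (curvature u t)"
      by (simp add: hyp_norm_def hyp_metric_def)
    also have "\<dots> = ((q t * k)\<^sup>2 + (p t * k)\<^sup>2) * (y t / n t)\<^sup>2 / (y t)\<^sup>2"
      using y0 n0 by (simp add: hyp_metric_def curv y_def inner_vec_def sum_2 power2_eq_square field_simps)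
    also have "\<dots> = (n t * n t) * k\<^sup>2 * (y t / n t)\<^sup>2 / (y t)\<^sup>2"
      unfolding n2 by (simp add: power2_eq_square algebra_simps)
    also have "\<dots> = k\<^sup>2" using y0 n0 by (simp add: field_simps power2_eq_square)
    finally show ?thesis
      using t(1) by (simp add: energy_density_def speed k_def y_def n_def)
  qed
  \<comment> \<open>The end points are excluded as well, since the weak derivative lives on the open
    interval.\<close>
  have "negligible (?Z \<union> {0, 1})" using neg by simp
  then have "AE t in lebesgue. t \<notin> ?Z \<union> {0, 1}"
    by (intro AE_not_in) (simp add: negligible_iff_null_sets)
  then have "AE t in lebesgue. ennreal ((hyp_norm (u t) (curvature u t))\<^sup>2 * speed u t) * indicator {0..1} t =
      ennreal (energy_density (u t $ 2) (p t) (q t) (g t) (h t)) * indicator {0..1} t"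
  proof eventually_elim
    case (elim t)
    then show ?case using eq[of t] by (cases "t \<in> {0..1}") simp_all
  qed
  then show ?thesis
    unfolding elastic_energy_def by (rule nn_integral_cong_AE)
qed

section \<open>The radial velocity of a loop\<close>

text \<open>
  With base point \<open>P = (X, Y)\<close>, position \<open>(x, y) = (X + d, Y + f)\<close> and velocity \<open>(p, q)\<close>, put
  \<open>A\<^sup>2 = d\<^sup>2 + f\<^sup>2\<close> and \<open>B\<^sup>2 = A\<^sup>2 + 4 y Y\<close> (the squared Euclidean distances to \<open>P\<close> and to its
  reflection in the boundary). Then \<open>tanh (r / 2) = A / B\<close>, hence \<open>coth r = (A\<^sup>2 + B\<^sup>2) / (2 A B)\<close>, and
  the components of \<open>grad r\<close> along the unit tangent and the unit normal are \<open>radial_num\<close> and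
  \<open>angular_num\<close> divided by \<open>\<bar>(p, q)\<bar> A B\<close>. Below, \<open>(g, h)\<close> is the acceleration.
\<close>

definition radial_num :: "real \<Rightarrow> real \<Rightarrow> real \<Rightarrow> real \<Rightarrow> real \<Rightarrow> real" where
  "radial_num d f y p q = 2 * y * (d * p + f * q) - (d\<^sup>2 + f\<^sup>2) * q"

definition angular_num :: "real \<Rightarrow> real \<Rightarrow> real \<Rightarrow> real \<Rightarrow> real \<Rightarrow> real" where
  "angular_num d f y p q = 2 * y * (f * p - d * q) - (d\<^sup>2 + f\<^sup>2) * p"

text \<open>Cleared form of |grad r| = 1, that is of w^2 + a^2 = 1.\<close>

lemma radial_angular_sum_squares:
  fixes d f Y p q :: real
  assumes "y = f + Y"
  shows "(radial_num d f y p q)\<^sup>2 + (angular_num d f y p q)\<^sup>2 =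
    (p\<^sup>2 + q\<^sup>2) * (d\<^sup>2 + f\<^sup>2) * (d\<^sup>2 + f\<^sup>2 + 4 * y * Y)"
  unfolding assms radial_num_def angular_num_def
  by (simp add: power2_eq_square algebra_simps)

text \<open>The second factor on the left is a linear form in the acceleration. On the velocity (p,
  q) it takes the value \<open>radial_num\<close>, on the normal (-q, p) the value
  \<open>angular_num\<close>, and |(p, q)|^2 (g, h) is the combination of these vectors with
  coefficients p g + q h and p h - q g.\<close>

lemma radial_deriv_acceleration:
  fixes d f y p q g h :: real
  shows "(p\<^sup>2 + q\<^sup>2) * (2 * y * d * g + (2 * y * f - (d\<^sup>2 + f\<^sup>2)) * h)
    = radial_num d f y p q * (p * g + q * h) + angular_num d f y p q * (p * h - q * g)"
  unfolding radial_num_def angular_num_def by (simp add: power2_eq_square algebra_simps)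

text \<open>The part of w' free of the acceleration, with denominators cleared. The term linear in
  \<open>angular_num\<close> becomes the summand p / |(p, q)| of the curvature, the square becomes
  coth r a^2.\<close>

lemma radial_deriv_velocity:
  fixes d f Y p q :: real
  assumes "y = f + Y"
  defines "A2 \<equiv> d\<^sup>2 + f\<^sup>2" and "B2 \<equiv> d\<^sup>2 + f\<^sup>2 + 4 * y * Y"
  shows "4 * y\<^sup>2 * (p\<^sup>2 + q\<^sup>2) * A2 * B2
     - y * radial_num d f y p q * (2 * (d * p + f * q) * B2 + (2 * (d * p + f * q) + 4 * q * Y) * A2)
    = 2 * A2 * B2 * p * angular_num d f y p q + (A2 + B2) * (angular_num d f y p q)\<^sup>2"
  unfolding assms radial_num_def angular_num_def by (simp add: power2_eq_square algebra_simps)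

text \<open>The formula w' = k a + coth r a^2 times the hyperbolic speed, as the parameter is not
  arclength. It is pure algebra: \<open>num'\<close> and \<open>Q'\<close> are what the product rule
  delivers, and the left side is the output of the quotient and root rules. So it can be applied at
  each parameter, with whatever values the almost everywhere derivatives \<open>g\<close> and
  \<open>h\<close> have there.\<close>

lemma radial_deriv:
  fixes d f Y y p q g h :: real
  assumes y: "y = f + Y" "y > 0" "Y > 0" and N: "p\<^sup>2 + q\<^sup>2 > 0" and A2: "d\<^sup>2 + f\<^sup>2 > 0"
  defines "A2 \<equiv> d\<^sup>2 + f\<^sup>2" and "B2 \<equiv> d\<^sup>2 + f\<^sup>2 + 4 * y * Y" and "N \<equiv> p\<^sup>2 + q\<^sup>2"
    and "num \<equiv> radial_num d f y p q" and "ang \<equiv> angular_num d f y p q"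
    and "Q \<equiv> (p\<^sup>2 + q\<^sup>2) * (d\<^sup>2 + f\<^sup>2) * (d\<^sup>2 + f\<^sup>2 + 4 * y * Y)"
  assumes num': "num' = 2 * y * (p\<^sup>2 + q\<^sup>2) + 2 * y * d * g + (2 * y * f - (d\<^sup>2 + f\<^sup>2)) * h"
    and Q': "Q' = 2 * (p * g + q * h) * A2 * B2
      + N * (2 * (d * p + f * q) * B2 + (2 * (d * p + f * q) + 4 * q * Y) * A2)"
  shows "(num' * sqrt Q - num * (Q' / (2 * sqrt Q))) / (sqrt Q)\<^sup>2 =
    (sqrt N / y) * (signed_curvature y p q g h * (ang / sqrt Q)
      + (A2 + B2) / (2 * sqrt (A2 * B2)) * (ang / sqrt Q)\<^sup>2)"
proof -
  define n S R where "n = sqrt N" and "S = sqrt (A2 * B2)" and "R = sqrt Q"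
  have pos: "N > 0" "A2 > 0" "B2 > 0"
    using N A2 y by (auto simp: N_def A2_def B2_def add_pos_pos)
  then have Q0: "Q > 0" "Q = N * A2 * B2"
    by (auto simp: Q_def A2_def B2_def N_def)
  have n: "n > 0" "n\<^sup>2 = N" and S: "S > 0" "S\<^sup>2 = A2 * B2" and R: "R > 0" "R\<^sup>2 = Q" "R = n * S"
    using pos Q0 by (auto simp: n_def S_def R_def real_sqrt_mult power_mult_distrib)
  define k where "k = p * h - q * g"
  have kap: "signed_curvature y p q g h = p / n + y * k / n ^ 3"
    by (simp add: signed_curvature_def n_def N_def k_def)
  have nk: "n * signed_curvature y p q g h = p + y * k / N"
    unfolding kap n(2)[symmetric] using n(1) by (simp add: field_simps power2_eq_square power3_eq_cube)
  have R1: "N * (2 * y * d * g + (2 * y * f - A2) * h) = num * (p * g + q * h) + ang * k"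
    using radial_deriv_acceleration[of p q y d g f h] by (simp add: N_def A2_def num_def ang_def k_def)
  have R2: "4 * y\<^sup>2 * N * A2 * B2 - y * num * (2 * (d * p + f * q) * B2 + (2 * (d * p + f * q) + 4 * q * Y) * A2)
    = 2 * A2 * B2 * p * ang + (A2 + B2) * ang\<^sup>2"
    using radial_deriv_velocity[OF y(1), of p q d] by (simp add: N_def A2_def B2_def num_def ang_def)
  \<comment> \<open>The derivative of A^2 B^2 along the velocity.\<close>
  define L where "L = 2 * (d * p + f * q) * B2 + (2 * (d * p + f * q) + 4 * q * Y) * A2"
  have e1: "2 * y * d * g + (2 * y * f - A2) * h = (num * (p * g + q * h) + ang * k) / N"
    using R1 pos by (simp add: field_simps)
  have e2: "2 * y * N - num * L / (2 * A2 * B2) = (2 * A2 * B2 * p * ang + (A2 + B2) * ang\<^sup>2) / (2 * y * A2 * B2)"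
    unfolding R2[symmetric] L_def[symmetric] using pos y(2) by (simp add: field_simps power2_eq_square)
  have e3: "num * (Q' / (2 * Q)) = num * (p * g + q * h) / N + num * L / (2 * A2 * B2)"
    unfolding Q' L_def[symmetric] Q0(2) using pos by (simp add: field_simps)
  have "num' - num * (Q' / (2 * Q)) = 2 * y * N + (2 * y * d * g + (2 * y * f - A2) * h) - num * (Q' / (2 * Q))"
    by (simp add: num' N_def A2_def)
  also have "\<dots> = (2 * y * N - num * L / (2 * A2 * B2)) + ang * k / N"
    unfolding e1 e3 by (simp add: add_divide_distrib)
  also have "\<dots> = ang / y * (p + y * k / N) + (A2 + B2) * ang\<^sup>2 / (2 * y * A2 * B2)"
    unfolding e2 using pos y(2) by (simp add: field_simps)
  also have "\<dots> = ang / y * (n * signed_curvature y p q g h) + (A2 + B2) * ang\<^sup>2 / (2 * y * S\<^sup>2)"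
    by (simp add: nk S)
  finally have T: "num' - num * (Q' / (2 * Q)) = \<dots>" .
  have "(num' * R - num * (Q' / (2 * R))) / R\<^sup>2 = (num' - num * (Q' / (2 * R\<^sup>2))) / R"
    using R(1) by (simp add: field_simps power2_eq_square)
  also have "\<dots> = (ang / y * (n * signed_curvature y p q g h) + (A2 + B2) * ang\<^sup>2 / (2 * y * S\<^sup>2)) / R"
    unfolding R(2) T ..
  also have "\<dots> = (n / y) * (signed_curvature y p q g h * (ang / R) + (A2 + B2) / (2 * S) * (ang / R)\<^sup>2)"
    unfolding R(3) using n(1) S(1) y(2) by (simp add: field_simps power2_eq_square)
  finally show ?thesis by (simp only: R_def n_def S_def)
qed

section \<open>The energy of a loop\<close>

lemma ennreal_integral_le_nn_integral:
  fixes \<phi> e :: "real \<Rightarrow> real"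
  assumes "\<phi> absolutely_integrable_on T" "T \<subseteq> S" "\<And>t. t \<in> T \<Longrightarrow> \<phi> t \<le> e t"
  shows "ennreal (integral T \<phi>) \<le> (\<integral>\<^sup>+t\<in>S. ennreal (e t) \<partial>lebesgue)"
proof -
  \<comment> \<open>The positive part turns the signed lower bound into an integrand for the
    nonnegative Lebesgue integral; \<open>ennreal\<close> truncates at 0 in the same way.\<close>
  have abs: "(\<lambda>t. max (\<phi> t) 0) absolutely_integrable_on T"
    using assms(1) by (intro absolutely_integrable_max_1) auto
  then have int: "(\<lambda>t. max (\<phi> t) 0) integrable_on T" "\<phi> integrable_on T"
    using assms(1) by (auto simp: set_lebesgue_integral_eq_integral(1))
  have "ennreal (integral T \<phi>) \<le> ennreal (integral T (\<lambda>t. max (\<phi> t) 0))"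
    by (intro ennreal_leI integral_le int) auto
  also have "\<dots> = (\<integral>\<^sup>+t. ennreal (max (\<phi> t) 0) * indicator T t \<partial>lborel)"
    by (rule nn_integral_has_integral_lebesgue'[symmetric]) (use int in \<open>auto simp: has_integral_integral\<close>)
  also have "\<dots> = (\<integral>\<^sup>+t. ennreal (max (\<phi> t) 0) * indicator T t \<partial>lebesgue)"
    by (simp add: nn_integral_completion)
  also have "\<dots> \<le> (\<integral>\<^sup>+t\<in>S. ennreal (e t) \<partial>lebesgue)"
  proof (rule nn_integral_mono)
    show "ennreal (max (\<phi> t) 0) * indicator T t \<le> ennreal (e t) * indicator S t" for t
    proof (cases "t \<in> T")
      case True
      have "ennreal (max (\<phi> t) 0) = ennreal (\<phi> t)" by (simp add: max_def ennreal_neg)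
      moreover have "t \<in> S" using True assms(2) by blast
      ultimately show ?thesis using True assms(3)[OF True] by (simp add: ennreal_leI)
    qed simp
  qed
  finally show ?thesis .
qed

lemma loop_energy_gt_8:
  fixes x y p q g h :: "real \<Rightarrow> real"
  assumes "a < b"
    and ac: "has_ac_deriv x p a b" "has_ac_deriv y q a b" "has_ac_deriv p g a b" "has_ac_deriv q h a b"
    and pos: "\<And>t. t \<in> {a..b} \<Longrightarrow> y t > 0" and imm: "\<And>t. t \<in> {a..b} \<Longrightarrow> (p t)\<^sup>2 + (q t)\<^sup>2 > 0"
    and loop: "x b = x a" "y b = y a"
    and ne: "\<And>t. a < t \<Longrightarrow> t < b \<Longrightarrow> (x t, y t) \<noteq> (x a, y a)"
  shows "(\<integral>\<^sup>+t\<in>{a..b}. ennreal (energy_density (y t) (p t) (q t) (g t) (h t)) \<partial>lebesgue) > 8"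
    (is "?E > 8")
proof (rule ccontr)
  assume "\<not> ?E > 8"
  then have E: "?E \<le> 8" by simp
  define Y where "Y = y a"
  define d f where "d t = x t - x a" and "f t = y t - Y" for t
  define A2 B2 N where "A2 t = (d t)\<^sup>2 + (f t)\<^sup>2" and "B2 t = (d t)\<^sup>2 + (f t)\<^sup>2 + 4 * y t * Y"
    and "N t = (p t)\<^sup>2 + (q t)\<^sup>2" for t
  define num ang Q where "num t = radial_num (d t) (f t) (y t) (p t) (q t)"
    and "ang t = angular_num (d t) (f t) (y t) (p t) (q t)" and "Q t = N t * A2 t * B2 t" for t
  define w where "w t = num t / sqrt (Q t)" for t
  define k where "k t = signed_curvature (y t) (p t) (q t) (g t) (h t)" for t
  \<comment> \<open>Speed times k a + coth r a^2, the derivative of \<open>w\<close>; then speed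
    times the surplus (coth r - 1) a^2.\<close>
  define W where "W t = (sqrt (N t) / y t) * (k t * (ang t / sqrt (Q t))
      + (A2 t + B2 t) / (2 * sqrt (A2 t * B2 t)) * (ang t / sqrt (Q t))\<^sup>2)" for t
  define m where "m t = (sqrt (N t) / y t) * ((A2 t + B2 t) / (2 * sqrt (A2 t * B2 t)) - 1) * (ang t / sqrt (Q t))\<^sup>2" for t
  have Y: "Y > 0" using pos \<open>a < b\<close> by (simp add: Y_def)
  have yf: "y t = f t + Y" for t by (simp add: f_def)
  have N: "N t > 0" if "t \<in> {a..b}" for t using imm[OF that] by (simp add: N_def)
  have A2: "A2 t > 0" if "t \<in> {a<..<b}" for t
    using ne[of t] that by (auto simp: A2_def d_def f_def Y_def sum_power2_gt_zero_iff)
  have BA: "B2 t > A2 t" if "t \<in> {a..b}" for t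
    using pos[OF that] Y by (simp add: A2_def B2_def)
  have Q: "Q t > 0" if "t \<in> {a<..<b}" for t
    using N[of t] A2[OF that] BA[of t] that by (auto simp: Q_def)
  have wsq: "(w t)\<^sup>2 + (ang t / sqrt (Q t))\<^sup>2 = 1" if "t \<in> {a<..<b}" for t
  proof -
    have "(num t)\<^sup>2 + (ang t)\<^sup>2 = Q t"
      using radial_angular_sum_squares[OF yf[of t], of "d t" "p t" "q t"]
      by (simp add: num_def ang_def Q_def N_def A2_def B2_def)
    then show ?thesis
      using Q[OF that] by (simp add: w_def power_divide add_divide_distrib[symmetric])
  qed
  have coth: "(A2 t + B2 t) / (2 * sqrt (A2 t * B2 t)) > 1" if "t \<in> {a<..<b}" for t
  proof -
    \<comment> \<open>Arithmetic-geometric mean inequality for A^2 and B^2, strict because they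
      differ by 4 y Y > 0.\<close>
    have "sqrt (A2 t) \<noteq> sqrt (B2 t)" using BA[of t] that by simp
    then have "0 < (sqrt (A2 t) - sqrt (B2 t))\<^sup>2" by simp
    also have "\<dots> = A2 t + B2 t - 2 * sqrt (A2 t * B2 t)"
      using A2[OF that] BA[of t] that by (simp add: power2_diff real_sqrt_mult)
    finally show ?thesis
      using A2[OF that] BA[of t] that by (simp add: field_simps)
  qed
  have m_nonneg: "m t \<ge> 0" if "t \<in> {a<..<b}" for t
    using coth[OF that] pos[of t] N[of t] that by (simp add: m_def)
  have completed_square: "4 * m t - 4 * W t \<le> energy_density (y t) (p t) (q t) (g t) (h t)"
    if "t \<in> {a<..<b}" for t
  proof -
    \<comment> \<open>\<open>K\<close> is the curvature, \<open>G\<close> the speed,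
      \<open>C\<close> is coth r and \<open>c\<close> the angular component a.\<close>
    have *: "K\<^sup>2 * G - (4 * (G * (C - 1) * c\<^sup>2) - 4 * (G * (K * c + C * c\<^sup>2))) = G * (K + 2 * c)\<^sup>2"
      for K G C c :: real by (simp add: power2_eq_square algebra_simps)
    have "energy_density (y t) (p t) (q t) (g t) (h t) - (4 * m t - 4 * W t) =
        (sqrt (N t) / y t) * (k t + 2 * (ang t / sqrt (Q t)))\<^sup>2"
      unfolding energy_density_def m_def W_def k_def[symmetric] N_def[symmetric] by (rule *)
    also have "\<dots> \<ge> 0" using pos[of t] N[of t] that by simp
    finally show ?thesis by simp
  qed
  have cont: "continuous_on {a..b} x" "continuous_on {a..b} y" "continuous_on {a..b} p" "continuous_on {a..b} q"
    using ac by (auto intro: has_ac_deriv_continuous_on)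
  \<comment> \<open>\<open>Q\<close> vanishes at both ends of the loop, so \<open>w\<close> is
    differentiated only on compact subintervals of \<open>(a, b)\<close>.\<close>
  have ac_w: "has_ac_deriv w W \<alpha> \<beta>" if "a < \<alpha>" "\<beta> < b" for \<alpha> \<beta>
  proof -
    have ac': "has_ac_deriv x p \<alpha> \<beta>" "has_ac_deriv y q \<alpha> \<beta>" "has_ac_deriv p g \<alpha> \<beta>" "has_ac_deriv q h \<alpha> \<beta>"
      using ac that by (auto intro: has_ac_deriv_subset)
    have d: "has_ac_deriv d p \<alpha> \<beta>"
      using has_ac_deriv_diff[OF ac'(1) has_ac_deriv_const[of "x a"]] by (simp add: d_def[abs_def])
    have f: "has_ac_deriv f q \<alpha> \<beta>"
      using has_ac_deriv_diff[OF ac'(2) has_ac_deriv_const[of Y]] by (simp add: f_def[abs_def])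
    have A2': "has_ac_deriv A2 (\<lambda>t. (p t * d t + d t * p t) + (q t * f t + f t * q t)) \<alpha> \<beta>"
      by (rule has_ac_deriv_cong[OF has_ac_deriv_add[OF has_ac_deriv_mult[OF d d] has_ac_deriv_mult[OF f f]]])
        (auto simp: A2_def power2_eq_square)
    have B2': "has_ac_deriv B2 (\<lambda>t. ((p t * d t + d t * p t) + (q t * f t + f t * q t)) + (4 * Y) * q t) \<alpha> \<beta>"
      by (rule has_ac_deriv_cong[OF has_ac_deriv_add[OF A2' has_ac_deriv_cmult[OF ac'(2), of "4 * Y"]]])
        (auto simp: A2_def B2_def power2_eq_square)
    have N': "has_ac_deriv N (\<lambda>t. (g t * p t + p t * g t) + (h t * q t + q t * h t)) \<alpha> \<beta>"
      by (rule has_ac_deriv_cong[OF has_ac_deriv_add[OF has_ac_deriv_mult[OF ac'(3,3)] has_ac_deriv_mult[OF ac'(4,4)]]])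
        (auto simp: N_def power2_eq_square)
    define Q' where "Q' t = 2 * (p t * g t + q t * h t) * A2 t * B2 t
      + N t * (2 * (d t * p t + f t * q t) * B2 t + (2 * (d t * p t + f t * q t) + 4 * q t * Y) * A2 t)" for t
    have Q': "has_ac_deriv Q Q' \<alpha> \<beta>"
      by (rule has_ac_deriv_cong[OF has_ac_deriv_mult[OF has_ac_deriv_mult[OF N' A2'] B2']])
        (auto simp: Q_def Q'_def algebra_simps)
    define num' where "num' t = 2 * y t * ((p t)\<^sup>2 + (q t)\<^sup>2) + 2 * y t * d t * g t
      + (2 * y t * f t - ((d t)\<^sup>2 + (f t)\<^sup>2)) * h t" for t
    have num': "has_ac_deriv num num' \<alpha> \<beta>"
      by (rule has_ac_deriv_cong[OF has_ac_deriv_diff[OF has_ac_deriv_mult[OF has_ac_deriv_cmult[OF ac'(2), of 2]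
            has_ac_deriv_add[OF has_ac_deriv_mult[OF d ac'(3)] has_ac_deriv_mult[OF f ac'(4)]]]
            has_ac_deriv_mult[OF A2' ac'(4)]]])
        (auto simp: num_def num'_def A2_def radial_num_def power2_eq_square algebra_simps)
    have in_ab: "t \<in> {a<..<b}" if "t \<in> {\<alpha>..\<beta>}" for t using that \<open>a < \<alpha>\<close> \<open>\<beta> < b\<close> by auto
    have "has_ac_deriv (\<lambda>t. num t / sqrt (Q t))
        (\<lambda>t. (num' t * sqrt (Q t) - num t * (Q' t / (2 * sqrt (Q t)))) / (sqrt (Q t))\<^sup>2) \<alpha> \<beta>"
      by (intro has_ac_deriv_divide has_ac_deriv_sqrt num' Q') (use Q[OF in_ab] in force)+
    then show ?thesis
    proof (rule has_ac_deriv_cong)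
      fix t assume "t \<in> {\<alpha>..\<beta>}"
      then have t: "t \<in> {a<..<b}" by (rule in_ab)
      then have t': "t \<in> {a..b}" by auto
      show "(num' t * sqrt (Q t) - num t * (Q' t / (2 * sqrt (Q t)))) / (sqrt (Q t))\<^sup>2 = W t"
        using radial_deriv[OF yf pos[OF t'] Y imm[OF t'] A2[OF t, unfolded A2_def] num'_def, of "Q' t"]
        by (simp add: Q'_def W_def k_def Q_def N_def A2_def B2_def num_def ang_def)
    qed (simp add: w_def)
  qed
  have cont_m: "continuous_on {\<alpha>..\<beta>} m" if "a < \<alpha>" "\<beta> < b" for \<alpha> \<beta>
  proof -
    have sub: "{\<alpha>..\<beta>} \<subseteq> {a..b}" "\<And>t. t \<in> {\<alpha>..\<beta>} \<Longrightarrow> t \<in> {a<..<b}" using that by auto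
    note c = cont[THEN continuous_on_subset, OF sub(1)]
    have cA: "continuous_on {\<alpha>..\<beta>} A2" "continuous_on {\<alpha>..\<beta>} B2" "continuous_on {\<alpha>..\<beta>} N"
      "continuous_on {\<alpha>..\<beta>} ang"
      unfolding A2_def B2_def N_def ang_def angular_num_def d_def f_def by (intro continuous_intros c)+
    then have cQ: "continuous_on {\<alpha>..\<beta>} Q" unfolding Q_def by (intro continuous_intros)
    have nz: "y t \<noteq> 0" "sqrt (Q t) \<noteq> 0" "2 * sqrt (A2 t * B2 t) \<noteq> 0" if "t \<in> {\<alpha>..\<beta>}" for t
      using sub(2)[OF that] pos[of t] Q[of t] A2[of t] BA[of t] by auto
    show ?thesis unfolding m_def
      by (intro continuous_intros cA cQ c) (use nz in auto)
  qed
  have main: "4 * integral {\<alpha>..\<beta>} m + 4 * (w \<alpha> - w \<beta>) \<le> 8" if ab: "a < \<alpha>" "\<alpha> \<le> \<beta>" "\<beta> < b" for \<alpha> \<beta>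
  proof -
    have W: "W absolutely_integrable_on {\<alpha>..\<beta>}" "(W has_integral (w \<beta> - w \<alpha>)) {\<alpha>..\<beta>}"
      using ac_w[OF ab(1,3)] ab(2) by (auto simp: has_ac_deriv_def)
    have m: "m absolutely_integrable_on {\<alpha>..\<beta>}" "m integrable_on {\<alpha>..\<beta>}"
      using cont_m[OF ab(1,3)] by (auto intro: absolutely_integrable_continuous_real integrable_continuous_real)
    have "((\<lambda>t. 4 * m t - 4 * W t) has_integral (4 * integral {\<alpha>..\<beta>} m - 4 * (w \<beta> - w \<alpha>))) {\<alpha>..\<beta>}"
      by (intro has_integral_diff has_integral_mult_right W m integrable_integral)
    then have "ennreal (4 * integral {\<alpha>..\<beta>} m - 4 * (w \<beta> - w \<alpha>)) = ennreal (integral {\<alpha>..\<beta>} (\<lambda>t. 4 * m t - 4 * W t))"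
      by (simp add: integral_unique)
    also have "\<dots> \<le> ?E"
    proof (rule ennreal_integral_le_nn_integral)
      show "(\<lambda>t. 4 * m t - 4 * W t) absolutely_integrable_on {\<alpha>..\<beta>}"
        by (intro set_integral_diff(1) set_integrable_mult_right m W)
      show "4 * m t - 4 * W t \<le> energy_density (y t) (p t) (q t) (g t) (h t)" if "t \<in> {\<alpha>..\<beta>}" for t
        using that ab by (intro completed_square) auto
    qed (use ab in auto)
    also have "\<dots> \<le> ennreal 8" using E by simp
    finally show ?thesis by (subst (asm) ennreal_le_iff) auto
  qed
  \<comment> \<open>At an end \<open>c\<close> both \<open>num\<close> and the root of
    \<open>Q\<close> vanish to first order. Dividing \<open>d\<close> and \<open>f\<close> by t - c
    cancels this zero up to the sign of t - c. As \<phi> tends to 1 at either end, \<open>w\<close>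
    tends to 1 at \<open>a\<close> and to -1 at \<open>b\<close>.\<close>
  define \<phi> where "\<phi> c t = (2 * y t * (d t / (t - c) * p t + f t / (t - c) * q t)
      - (t - c) * ((d t / (t - c))\<^sup>2 + (f t / (t - c))\<^sup>2) * q t)
      / sqrt (N t * ((d t / (t - c))\<^sup>2 + (f t / (t - c))\<^sup>2) * B2 t)" for c t
  have w_\<phi>: "w t = sgn (t - c) * \<phi> c t" if "t \<noteq> c" for t c
  proof -
    define z D F where "z = t - c" and "D = d t / z" and "F = f t / z"
    have z: "z \<noteq> 0" "d t = z * D" "f t = z * F" using that by (auto simp: z_def D_def F_def)
    have "num t = z * (2 * y t * (D * p t + F * q t) - z * (D\<^sup>2 + F\<^sup>2) * q t)"
      by (simp add: num_def radial_num_def z power2_eq_square algebra_simps)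
    moreover have "Q t = z\<^sup>2 * (N t * (D\<^sup>2 + F\<^sup>2) * B2 t)"
      by (simp add: Q_def A2_def z power_mult_distrib algebra_simps)
    ultimately have "w t = z / \<bar>z\<bar> * \<phi> c t"
      by (simp add: w_def \<phi>_def real_sqrt_mult z_def[symmetric] D_def[symmetric] F_def[symmetric])
    then show ?thesis by (simp only: z_def real_sgn_eq)
  qed
  have \<phi>_lim: "(\<phi> c \<longlongrightarrow> 1) (at c within {a..b})" if c: "c = a \<or> c = b" for c
  proof -
    have cin: "c \<in> {a..b}" and c0: "x c = x a" "y c = Y" using c \<open>a < b\<close> loop by (auto simp: Y_def)
    have "((\<lambda>t. (x t - x c) / (t - c)) \<longlongrightarrow> p c) (at c within {a..b})"
      "((\<lambda>t. (y t - y c) / (t - c)) \<longlongrightarrow> q c) (at c within {a..b})"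
      using has_ac_deriv_imp_has_vector_derivative[OF ac(1) cont(3) cin]
        has_ac_deriv_imp_has_vector_derivative[OF ac(2) cont(4) cin]
      by (auto simp: has_real_derivative_iff_has_vector_derivative[symmetric] has_field_derivative_iff)
    then have quot: "((\<lambda>t. d t / (t - c)) \<longlongrightarrow> p c) (at c within {a..b})"
      "((\<lambda>t. f t / (t - c)) \<longlongrightarrow> q c) (at c within {a..b})"
      by (simp_all add: d_def f_def c0)
    have lims: "(x \<longlongrightarrow> x a) (at c within {a..b})" "(y \<longlongrightarrow> Y) (at c within {a..b})"
      "(p \<longlongrightarrow> p c) (at c within {a..b})" "(q \<longlongrightarrow> q c) (at c within {a..b})"
      using cont[unfolded continuous_on_def, THEN bspec, OF cin] by (simp_all only: c0)
    have df_lims: "(d \<longlongrightarrow> x a - x a) (at c within {a..b})" "(f \<longlongrightarrow> Y - Y) (at c within {a..b})"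
      unfolding d_def f_def by (intro tendsto_intros lims)+
    \<comment> \<open>The quotients tend to the velocity v = (p, q) at \<open>c\<close>, and B tends
      to 2 Y, so the limit is 2 Y |v|^2 / (|v| |v| 2 Y).\<close>
    have "((\<lambda>t. \<phi> c t) \<longlongrightarrow> (2 * Y * (p c * p c + q c * q c) - (c - c) * ((p c)\<^sup>2 + (q c)\<^sup>2) * q c)
      / sqrt (((p c)\<^sup>2 + (q c)\<^sup>2) * ((p c)\<^sup>2 + (q c)\<^sup>2) * ((x a - x a)\<^sup>2 + (Y - Y)\<^sup>2 + 4 * Y * Y)))
      (at c within {a..b})"
      unfolding \<phi>_def N_def B2_def
      by (intro tendsto_intros quot lims df_lims) (use imm[OF cin] Y in auto)
    also have "(2 * Y * (p c * p c + q c * q c) - (c - c) * ((p c)\<^sup>2 + (q c)\<^sup>2) * q c)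
      / sqrt (((p c)\<^sup>2 + (q c)\<^sup>2) * ((p c)\<^sup>2 + (q c)\<^sup>2) * ((x a - x a)\<^sup>2 + (Y - Y)\<^sup>2 + 4 * Y * Y)) = 1"
    proof -
      have "sqrt (((p c)\<^sup>2 + (q c)\<^sup>2) * ((p c)\<^sup>2 + (q c)\<^sup>2) * (4 * Y * Y)) = 2 * Y * ((p c)\<^sup>2 + (q c)\<^sup>2)"
        by (rule real_sqrt_unique) (use Y in \<open>auto simp: power2_eq_square algebra_simps\<close>)
      then show ?thesis using imm[OF cin] Y by (auto simp: power2_eq_square)
    qed
    finally show ?thesis .
  qed
  have near: "\<exists>r>0. \<forall>t. t \<in> {a<..<b} \<and> \<bar>t - c\<bar> < r \<longrightarrow> \<phi> c t > 1 - \<delta>"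
    if "c = a \<or> c = b" "\<delta> > 0" for c \<delta>
  proof -
    have "\<forall>\<^sub>F t in at c within {a..b}. \<phi> c t > 1 - \<delta>"
      by (rule order_tendstoD(1)[OF \<phi>_lim[OF that(1)]]) (use that in auto)
    then show ?thesis
      using that(1) by (force simp: eventually_at dist_real_def)
  qed
  \<comment> \<open>The new interval encloses any prescribed one, so a surplus fixed beforehand
    survives when \<delta> is chosen in terms of it.\<close>
  have ends: "\<exists>\<alpha> \<beta>. a < \<alpha> \<and> \<alpha> < \<alpha>' \<and> \<beta>' < \<beta> \<and> \<beta> < b \<and> w \<alpha> > 1 - \<delta> \<and> w \<beta> < \<delta> - 1"
    if ab': "a < \<alpha>'" "\<beta>' < b" "\<delta> > 0" for \<alpha>' \<beta>' \<delta>
  proof -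
    obtain r where r: "r > 0" "\<And>t. t \<in> {a<..<b} \<Longrightarrow> \<bar>t - a\<bar> < r \<Longrightarrow> \<phi> a t > 1 - \<delta>"
      using near[OF disjI1[OF refl] ab'(3)] by blast
    obtain s where s: "s > 0" "\<And>t. t \<in> {a<..<b} \<Longrightarrow> \<bar>t - b\<bar> < s \<Longrightarrow> \<phi> b t > 1 - \<delta>"
      using near[OF disjI2[OF refl] ab'(3)] by blast
    define \<alpha> where "\<alpha> = a + min (min r (\<alpha>' - a)) (b - a) / 2"
    define \<beta> where "\<beta> = b - min (min s (b - \<beta>')) (b - a) / 2"
    have \<alpha>: "a < \<alpha>" "\<alpha> < \<alpha>'" "\<alpha> < b" "\<bar>\<alpha> - a\<bar> < r"
      using r(1) ab' \<open>a < b\<close> by (auto simp: \<alpha>_def min_def field_simps)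
    have \<beta>: "\<beta> < b" "\<beta>' < \<beta>" "a < \<beta>" "\<bar>\<beta> - b\<bar> < s"
      using s(1) ab' \<open>a < b\<close> by (auto simp: \<beta>_def min_def field_simps)
    have "w \<alpha> > 1 - \<delta>" using r(2)[of \<alpha>] w_\<phi>[of \<alpha> a] \<alpha> by simp
    moreover have "w \<beta> < \<delta> - 1" using s(2)[of \<beta>] w_\<phi>[of \<beta> b] \<beta> by simp
    ultimately show ?thesis using \<alpha> \<beta> by blast
  qed
  obtain \<alpha>\<^sub>0 \<beta>\<^sub>0 where ab0: "a < \<alpha>\<^sub>0" "\<alpha>\<^sub>0 < (a + b) / 2" "(a + b) / 2 < \<beta>\<^sub>0" "\<beta>\<^sub>0 < b" "w \<alpha>\<^sub>0 > 0" "w \<beta>\<^sub>0 < 0"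
    using ends[of "(a + b) / 2" "(a + b) / 2" 1] \<open>a < b\<close> by auto
  then have lt0: "\<alpha>\<^sub>0 < \<beta>\<^sub>0" by linarith
  obtain t0 where t0: "\<alpha>\<^sub>0 \<le> t0" "t0 \<le> \<beta>\<^sub>0" "w t0 = 0"
    using IVT2'[of w \<beta>\<^sub>0 0 \<alpha>\<^sub>0] ab0 lt0 has_ac_deriv_continuous_on[OF ac_w[OF ab0(1,4)]] by auto
  have t0_ab: "t0 \<in> {a<..<b}" using t0 ab0 by auto
  \<comment> \<open>At a zero of \<open>w\<close> the velocity is orthogonal to grad r, so a^2 = 1
    and the surplus is positive.\<close>
  have "m t0 > 0"
    using wsq[OF t0_ab] t0(3) coth[OF t0_ab] pos[of t0] N[of t0] t0_ab by (simp add: m_def)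
  define \<mu> where "\<mu> = integral {\<alpha>\<^sub>0..\<beta>\<^sub>0} m"
  have in_ab: "t \<in> {a<..<b}" if "t \<in> {\<alpha>\<^sub>0..\<beta>\<^sub>0}" for t using that ab0 by auto
  have "\<mu> \<noteq> 0"
    using integral_eq_0_iff[OF cont_m[OF ab0(1,4)] lt0] m_nonneg[OF in_ab] t0 \<open>m t0 > 0\<close>
    unfolding \<mu>_def by force
  moreover have "\<mu> \<ge> 0" unfolding \<mu>_def
    by (intro integral_nonneg integrable_continuous_real cont_m ab0) (use m_nonneg[OF in_ab] in auto)
  ultimately have \<mu>: "\<mu> > 0" by simp
  \<comment> \<open>With \<delta> = \<mu> / 4 the left side of \<open>main\<close> exceeds 4 \<mu> +
    4 (2 - \<mu> / 2) = 8 + 2 \<mu>.\<close>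
  obtain \<alpha> \<beta> where ab1: "a < \<alpha>" "\<alpha> < \<alpha>\<^sub>0" "\<beta>\<^sub>0 < \<beta>" "\<beta> < b" "w \<alpha> > 1 - \<mu> / 4" "w \<beta> < \<mu> / 4 - 1"
    using ends[of \<alpha>\<^sub>0 \<beta>\<^sub>0 "\<mu> / 4"] ab0 \<mu> by auto
  have "\<mu> \<le> integral {\<alpha>..\<beta>} m" unfolding \<mu>_def
    by (intro integral_subset_le integrable_continuous_real cont_m ab0 ab1) (use ab1 m_nonneg in auto)
  moreover have "4 * integral {\<alpha>..\<beta>} m + 4 * (w \<alpha> - w \<beta>) \<le> 8"
    by (rule main) (use ab1 lt0 in auto)
  ultimately show False using ab1(5,6) \<mu> by argo
qed

section \<open>First return to a point, and injectivity\<close>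

lemma isolated_if_nonzero_derivative:
  assumes "has_ac_deriv x p 0 1" "continuous_on {0..1} p" "a \<in> {0..1}" "p a \<noteq> (0::real)"
  shows "\<forall>\<^sub>F t in at a within {0..1}. x t \<noteq> x a"
proof -
  have "((\<lambda>t. (x t - x a) / (t - a)) \<longlongrightarrow> p a) (at a within {0..1})"
    using has_ac_deriv_imp_has_vector_derivative[OF assms(1-3)]
    by (simp add: has_real_derivative_iff_has_vector_derivative[symmetric] has_field_derivative_iff)
  from tendsto_imp_eventually_ne[OF this assms(4)] show ?thesis
    by eventually_elim auto
qed

theorem theorem1p3:
  fixes u :: "real \<Rightarrow> real^2"
  assumes "u \<in> W22_H2" and "immersion u" and "elastic_energy u \<le> 8"
  shows "embedding u"
proof -
  have u: "u \<in> W22" "u ` {0..1} \<subseteq> H2" using assms(1) by (auto simp: W22_H2_def)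
  then obtain p q g h where ac: "has_ac_deriv (\<lambda>t. u t $ 1) p 0 1" "has_ac_deriv (\<lambda>t. u t $ 2) q 0 1"
      "has_ac_deriv p g 0 1" "has_ac_deriv q h 0 1"
    and dx: "\<And>t. t \<in> {0..1} \<Longrightarrow> dx u t = vector [p t, q t]"
    using W22_real2 by blast
  have pos: "u t $ 2 > 0" if "t \<in> {0..1}" for t using image_subset_iff[THEN iffD1, OF u(2)] that by (simp add: H2_def)
  have pq: "p t \<noteq> 0 \<or> q t \<noteq> 0" if "t \<in> {0..1}" for t
    using assms(2) dx[OF that] that by (auto simp: immersion_def vec_eq_iff forall_2)
  then have imm: "(p t)\<^sup>2 + (q t)\<^sup>2 > 0" if "t \<in> {0..1}" for t
    using that by (auto simp: sum_power2_gt_zero_iff)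
  have energy: "elastic_energy u =
      (\<integral>\<^sup>+t\<in>{0..1}. ennreal (energy_density (u t $ 2) (p t) (q t) (g t) (h t)) \<partial>lebesgue)"
    by (rule elastic_energy_eq[OF ac dx pos imm])
  have cont: "continuous_on {0..1} u" using u(1) by (simp add: W22_def)
  have no_return: "u s \<noteq> u t" if st: "s \<in> {0..1}" "t \<in> {0..1}" "s < t" for s t
  proof
    assume eq: "u s = u t"
    have "\<forall>\<^sub>F \<tau> in at s within {0..1}. u \<tau> \<noteq> u s"
      using pq[OF st(1)]
    proof
      assume "p s \<noteq> 0"
      from isolated_if_nonzero_derivative[OF ac(1) has_ac_deriv_continuous_on[OF ac(3)] st(1) this]
      show ?thesis by eventually_elim auto
    next
      assume "q s \<noteq> 0"
      from isolated_if_nonzero_derivative[OF ac(2) has_ac_deriv_continuous_on[OF ac(4)] st(1) this]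
      show ?thesis by eventually_elim auto
    qed
    then obtain r where r: "r > 0" "\<And>\<tau>. \<tau> \<in> {0..1} \<Longrightarrow> s < \<tau> \<Longrightarrow> \<tau> < s + r \<Longrightarrow> u \<tau> \<noteq> u s"
      by (force simp: eventually_at dist_real_def)
    \<comment> \<open>The velocity at \<open>s\<close> is nonzero, so the curve avoids
      \<open>u s\<close> for a time \<open>r\<close>. Cutting at s + r keeps the set of later
      returns closed, so there is a first one, \<open>b\<close>, and the curve on
      \<open>[s, b]\<close> is a loop that meets its base point only at the ends.\<close>
    define K where "K = {\<tau> \<in> {s + r..t}. u \<tau> = u s}"
    have "t \<in> K" using r(2)[of t] st eq by (force simp: K_def)
    have "continuous_on {s + r..t} u"
      by (rule continuous_on_subset[OF cont]) (use st r in auto)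
    then have "closed K" unfolding K_def by (intro continuous_closed_preimage_constant) auto
    moreover have "bounded K"
      by (rule bounded_subset[of "{s + r..t}"]) (auto simp: K_def)
    ultimately have "compact K"
      by (simp add: compact_eq_bounded_closed)
    then obtain b where b: "b \<in> K" "\<And>\<tau>. \<tau> \<in> K \<Longrightarrow> b \<le> \<tau>"
      using compact_attains_inf[of K] \<open>t \<in> K\<close> by blast
    have sb: "s < b" "b \<le> t" "u b = u s" using b(1) r(1) by (auto simp: K_def)
    have sub: "\<tau> \<in> {0..1}" if "\<tau> \<in> {s..b}" for \<tau> using that sb st by auto
    have ne: "u \<tau> \<noteq> u s" if "s < \<tau>" "\<tau> < b" for \<tau>
    proof (cases "\<tau> < s + r")
      case True then show ?thesis using r(2)[of \<tau>] sub[of \<tau>] that by auto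
    next
      case False then show ?thesis using b(2)[of \<tau>] that sb by (force simp: K_def)
    qed
    have "8 < (\<integral>\<^sup>+\<tau>\<in>{s..b}. ennreal (energy_density (u \<tau> $ 2) (p \<tau>) (q \<tau>) (g \<tau>) (h \<tau>)) \<partial>lebesgue)"
    proof (rule loop_energy_gt_8[OF sb(1)])
      show "has_ac_deriv (\<lambda>t. u t $ 1) p s b" "has_ac_deriv (\<lambda>t. u t $ 2) q s b"
        "has_ac_deriv p g s b" "has_ac_deriv q h s b"
        using ac sb st by (auto intro: has_ac_deriv_subset)
      show "(u \<tau> $ 1, u \<tau> $ 2) \<noteq> (u s $ 1, u s $ 2)" if "s < \<tau>" "\<tau> < b" for \<tau>
        using ne[OF that] by (auto simp: vec_eq_iff forall_2)
    qed (use pos imm sub sb in auto)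
    \<comment> \<open>The integrand is nonnegative, so a part of the curve has at most the energy of
      the whole.\<close>
    also have "\<dots> \<le> elastic_energy u"
      unfolding energy
      by (intro nn_integral_mono) (use sub in \<open>auto simp: indicator_def\<close>)
    finally show False using assms(3) by simp
  qed
  have "inj_on u {0..1}"
  proof (rule inj_onI)
    fix s t assume "s \<in> {0..1}" "t \<in> {0..1}" "u s = u t"
    then show "s = t" using no_return[of s t] no_return[of t s] by (cases s t rule: linorder_cases) auto
  qed
  moreover have "continuous_map (top_of_set {0..1}) (top_of_set H2) u"
    using cont u(2) by (auto simp: continuous_map_in_subtopology)
  ultimately have "embedding_map (top_of_set {0..1}) (top_of_set H2) u"
    by (intro continuous_imp_embedding_map) (auto simp: Hausdorff_space_subtopology compact_space_subtopology)
  then show ?thesis using assms(2) by (simp add: embedding_def)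
qed

end
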